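(* Let $X$ be a complex Banach space which is 1-complemented in its second dual, i.e. (regarding $X\subset X^{**}$ via the canonical embedding) there is a linear projection of norm 1 from $X^{**}$ onto $X$. Then the open unit ball $B_X$ of $X$ is C-connected: every pair of distinct points of $B_X$ can be joined by a complex geodesic in $B_X$.
   Context: $\mathbb{D}$ is the open unit disc in $\mathbb{C}$ and $\rho(z,w)=\tanh^{-1}\left|\frac{z-w}{1-\bar w z}\right|$ is the Poincaré distance on $\mathbb{D}$. For domains $\mathcal{D}_1,\mathcal{D}_2$ in complex Banach spaces, $H(\mathcal{D}_1,\mathcal{D}_2)$ is the set of holomorphic maps $\mathcal{D}_1\to\mathcal{D}_2$. The Carathéodory distance on a domain $\mathcal{D}$ is $C_{\mathcal{D}}(p,q)=\sup\{\rho(f(p),f(q)): f\in H(\mathcal{D},\mathbb{D})\}$. A map $\phi\in H(\mathbb{D},\mathcal{D})$ is a complex geodesic if $\rho(u,v)=C_{\mathcal{D}}(\phi(u),\phi(v))$ for all $u,v\in\mathbb{D}$; it joins distinct points $z,w\in\mathcal{D}$ if $z,w\in\phi(\mathbb{D})$. A domain $\mathcal{D}$ is called C-connected if every pair of (distinct) points of $\mathcal{D}$ can be joined by a complex geodesic. *)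

theory Defs
  imports "HOL-Analysis.Analysis"
begin

subsection \<open>Complex normed and Banach spaces\<close>

text \<open>
  A complex normed space is a real one with a compatible complex scalar multiplication, so all of
  the library for real normed spaces applies to the underlying real structure.
\<close>

class complex_normed_vector = real_normed_vector +
  fixes scaleC :: "complex \<Rightarrow> 'a \<Rightarrow> 'a" (infixr "*\<^sub>C" 75)
  assumes scaleC_add_right: "a *\<^sub>C (x + y) = a *\<^sub>C x + a *\<^sub>C y"
    and scaleC_add_left: "(a + b) *\<^sub>C x = a *\<^sub>C x + b *\<^sub>C x"
    and scaleC_scaleC: "a *\<^sub>C b *\<^sub>C x = (a * b) *\<^sub>C x"
    and scaleC_of_real: "complex_of_real r *\<^sub>C x = r *\<^sub>R x"
    and norm_scaleC: "norm (a *\<^sub>C x) = cmod a * norm x"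

class complex_banach = complex_normed_vector + banach

instantiation complex :: complex_banach
begin

definition scaleC_complex :: "complex \<Rightarrow> complex \<Rightarrow> complex"
  where "scaleC_complex a x = a * x"

instance
  by standard
    (simp_all add: scaleC_complex_def ring_distribs norm_mult scaleR_conv_of_real)

end

definition bounded_clinear ::
    "('a::complex_normed_vector \<Rightarrow> 'b::complex_normed_vector) \<Rightarrow> bool"
  where "bounded_clinear f \<longleftrightarrow> bounded_linear f \<and> (\<forall>c x. f (c *\<^sub>C x) = c *\<^sub>C f x)"

lemma bounded_clinear_complex_iff:
  "bounded_clinear (f :: 'a::complex_normed_vector \<Rightarrow> complex) \<longleftrightarrow>
     bounded_linear f \<and> (\<forall>c x. f (c *\<^sub>C x) = c * f x)"
  by (simp add: bounded_clinear_def scaleC_complex_def)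


subsection \<open>The dual space and the canonical embedding into the bidual\<close>

typedef (overloaded) 'a cdual =
  "{f :: 'a::complex_normed_vector \<Rightarrow> complex. bounded_clinear f}"
  morphisms cdual_apply Abs_cdual
  by (rule exI[of _ "\<lambda>_. 0"]) (simp add: bounded_clinear_complex_iff)

setup_lifting type_definition_cdual

instantiation cdual :: (complex_normed_vector) complex_normed_vector
begin

lift_definition norm_cdual :: "'a cdual \<Rightarrow> real" is onorm .

lift_definition zero_cdual :: "'a cdual" is "\<lambda>_. 0"
  by (simp add: bounded_clinear_complex_iff)

lift_definition plus_cdual :: "'a cdual \<Rightarrow> 'a cdual \<Rightarrow> 'a cdual" is "\<lambda>f g x. f x + g x"
  by (simp add: bounded_clinear_complex_iff bounded_linear_add ring_distribs)

lift_definition minus_cdual :: "'a cdual \<Rightarrow> 'a cdual \<Rightarrow> 'a cdual" is "\<lambda>f g x. f x - g x"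
  by (simp add: bounded_clinear_complex_iff bounded_linear_sub ring_distribs)

lift_definition uminus_cdual :: "'a cdual \<Rightarrow> 'a cdual" is "\<lambda>f x. - f x"
  by (simp add: bounded_clinear_complex_iff bounded_linear_minus)

lift_definition scaleR_cdual :: "real \<Rightarrow> 'a cdual \<Rightarrow> 'a cdual" is "\<lambda>r f x. r *\<^sub>R f x"
  by (simp add: bounded_clinear_complex_iff bounded_linear_const_scaleR)

lift_definition scaleC_cdual :: "complex \<Rightarrow> 'a cdual \<Rightarrow> 'a cdual" is "\<lambda>c f x. c * f x"
  by (simp add: bounded_clinear_complex_iff bounded_linear_const_mult)

definition dist_cdual :: "'a cdual \<Rightarrow> 'a cdual \<Rightarrow> real"
  where "dist_cdual f g = norm (f - g)"

definition sgn_cdual :: "'a cdual \<Rightarrow> 'a cdual"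
  where "sgn_cdual f = inverse (norm f) *\<^sub>R f"

definition uniformity_cdual :: "('a cdual \<times> 'a cdual) filter"
  where "uniformity_cdual = (INF e\<in>{0 <..}. principal {(x, y). dist x y < e})"

definition open_cdual :: "'a cdual set \<Rightarrow> bool"
  where "open_cdual S = (\<forall>x\<in>S. \<forall>\<^sub>F (x', y) in uniformity. x' = x \<longrightarrow> y \<in> S)"

instance
proof
  fix f g h :: "'a cdual" and a b :: complex and r s :: real
  show "f + g + h = f + (g + h)" "f + g = g + f" "0 + f = f" "- f + f = 0" "f - g = f + - g"
    by (transfer; simp add: algebra_simps)+
  show "r *\<^sub>R (f + g) = r *\<^sub>R f + r *\<^sub>R g" "(r + s) *\<^sub>R f = r *\<^sub>R f + s *\<^sub>R f"
    "r *\<^sub>R s *\<^sub>R f = (r * s) *\<^sub>R f" "1 *\<^sub>R f = f"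
    by (transfer; simp add: algebra_simps)+
  show "a *\<^sub>C (f + g) = a *\<^sub>C f + a *\<^sub>C g" "(a + b) *\<^sub>C f = a *\<^sub>C f + b *\<^sub>C f"
    "a *\<^sub>C b *\<^sub>C f = (a * b) *\<^sub>C f" "complex_of_real r *\<^sub>C f = r *\<^sub>R f"
    by (transfer; simp add: algebra_simps scaleR_conv_of_real)+
  show "norm f = 0 \<longleftrightarrow> f = 0"
    by transfer (auto simp: bounded_clinear_def onorm_eq_0)
  show "norm (f + g) \<le> norm f + norm g"
    by transfer (auto simp: bounded_clinear_def onorm_triangle)
  show "norm (r *\<^sub>R f) = \<bar>r\<bar> * norm f"
    by transfer (auto simp: bounded_clinear_def onorm_scaleR)
  show "norm (a *\<^sub>C f) = cmod a * norm f"
  proof (transfer fixing: a)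
    fix f :: "'a \<Rightarrow> complex"
    assume "bounded_clinear f"
    then have f: "bounded_linear f" and af: "bounded_linear (\<lambda>x. a * f x)"
      by (auto simp: bounded_clinear_def bounded_linear_const_mult)
    have le: "onorm (\<lambda>x. c * h x) \<le> cmod c * onorm h"
      if "bounded_linear h" for c and h :: "'a \<Rightarrow> complex"
    proof (rule onorm_bound)
      show "0 \<le> cmod c * onorm h"
        using onorm_pos_le[OF that] by simp
      show "norm (c * h x) \<le> cmod c * onorm h * norm x" for x
        using mult_left_mono[OF onorm[OF that, of x], of "cmod c"] by (simp add: norm_mult mult.assoc)
    qed
    show "onorm (\<lambda>x. a * f x) = cmod a * onorm f"
    proof (cases "a = 0")
      case True
      then show ?thesis by (simp add: onorm_zero)
    next
      case False
      then have "onorm f \<le> inverse (cmod a) * onorm (\<lambda>x. a * f x)"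
        using le[OF af, of "inverse a"] by (simp add: norm_inverse mult.assoc[symmetric])
      then have "cmod a * onorm f \<le> onorm (\<lambda>x. a * f x)"
        using False by (simp add: field_simps)
      with le[OF f, of a] show ?thesis by simp
    qed
  qed
qed (simp_all add: dist_cdual_def sgn_cdual_def uniformity_cdual_def open_cdual_def)

end

lemma bounded_clinear_cdual_apply: "bounded_clinear (cdual_apply f)"
  using cdual_apply by simp

lemma norm_cdual_apply_le: "cmod (cdual_apply f x) \<le> norm f * norm x"
  by transfer (simp add: bounded_clinear_def onorm)

lift_definition bidual_embed :: "'a::complex_normed_vector \<Rightarrow> 'a cdual cdual"
  is "\<lambda>x f. cdual_apply f x"
proof -
  fix x :: 'a
  have "bounded_linear (\<lambda>f. cdual_apply f x)"
    by (rule bounded_linear_intro[where K = "norm x"])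
      (simp_all add: plus_cdual.rep_eq scaleR_cdual.rep_eq norm_cdual_apply_le)
  then show "bounded_clinear (\<lambda>f. cdual_apply f x)"
    by (simp add: bounded_clinear_complex_iff scaleC_cdual.rep_eq)
qed

definition one_complemented_in_bidual :: "'a::complex_banach itself \<Rightarrow> bool"
  where "one_complemented_in_bidual _ \<longleftrightarrow>
    (\<exists>P :: 'a cdual cdual \<Rightarrow> 'a cdual cdual.
       bounded_clinear P \<and> P \<circ> P = P \<and> range P = range (bidual_embed :: 'a \<Rightarrow> _) \<and> onorm P = 1)"


subsection \<open>Holomorphic maps, the Caratheodory distance and complex geodesics\<close>

definition cdomain :: "'a::complex_normed_vector set \<Rightarrow> bool"
  where "cdomain D \<longleftrightarrow> D \<noteq> {} \<and> open D \<and> connected D"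

text \<open>
  Holomorphy is complex Frechet differentiability at every point. Maps are total functions, of
  which only the restriction to the first domain matters.
\<close>

definition holomorphic_maps ::
    "'a::complex_normed_vector set \<Rightarrow> 'b::complex_normed_vector set \<Rightarrow> ('a \<Rightarrow> 'b) set"
  where "holomorphic_maps D\<^sub>1 D\<^sub>2 =
    {f. f ` D\<^sub>1 \<subseteq> D\<^sub>2 \<and> (\<forall>x\<in>D\<^sub>1. \<exists>f'. bounded_clinear f' \<and> (f has_derivative f') (at x))}"

abbreviation unit_disc :: "complex set"
  where "unit_disc \<equiv> ball 0 1"

definition poincare_dist :: "complex \<Rightarrow> complex \<Rightarrow> real"
  where "poincare_dist z w = artanh (cmod ((z - w) / (1 - cnj w * z)))"

text \<open>
  The supremum is taken in the extended reals, so that the definition does not depend on the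
  set of values being bounded.
\<close>

definition caratheodory_dist :: "'a::complex_normed_vector set \<Rightarrow> 'a \<Rightarrow> 'a \<Rightarrow> ereal"
  where "caratheodory_dist D p q =
    (SUP f\<in>holomorphic_maps D unit_disc. ereal (poincare_dist (f p) (f q)))"

definition complex_geodesic ::
    "'a::complex_normed_vector set \<Rightarrow> (complex \<Rightarrow> 'a) \<Rightarrow> bool"
  where "complex_geodesic D \<phi> \<longleftrightarrow>
    \<phi> \<in> holomorphic_maps unit_disc D \<and>
    (\<forall>u\<in>unit_disc. \<forall>v\<in>unit_disc.
       ereal (poincare_dist u v) = caratheodory_dist D (\<phi> u) (\<phi> v))"

definition C_connected :: "'a::complex_normed_vector set \<Rightarrow> bool"
  where "C_connected D \<longleftrightarrow>
    cdomain D \<and>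
    (\<forall>z\<in>D. \<forall>w\<in>D. z \<noteq> w \<longrightarrow>
       (\<exists>\<phi>. complex_geodesic D \<phi> \<and> z \<in> \<phi> ` unit_disc \<and> w \<in> \<phi> ` unit_disc))"

lemma holomorphic_maps_complex_iff:
  fixes f :: "complex \<Rightarrow> complex"
  assumes "open D\<^sub>1"
  shows "f \<in> holomorphic_maps D\<^sub>1 D\<^sub>2 \<longleftrightarrow> f holomorphic_on D\<^sub>1 \<and> f ` D\<^sub>1 \<subseteq> D\<^sub>2"
proof -
  have "(\<exists>f'. bounded_clinear f' \<and> (f has_derivative f') (at x)) \<longleftrightarrow> f field_differentiable (at x)"
    for x
  proof
    assume "\<exists>f'. bounded_clinear f' \<and> (f has_derivative f') (at x)"
    then obtain f' where f': "bounded_clinear f'" and d: "(f has_derivative f') (at x)"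
      by blast
    have "f' = (*) (f' 1)"
    proof
      fix h
      have "f' (h *\<^sub>C 1) = h * f' 1"
        using f' by (simp only: bounded_clinear_complex_iff)
      then show "f' h = f' 1 * h"
        by (simp add: scaleC_complex_def mult.commute)
    qed
    with d show "f field_differentiable (at x)"
      unfolding field_differentiable_def has_field_derivative_def by metis
  next
    assume "f field_differentiable (at x)"
    then obtain c where "(f has_derivative (*) c) (at x)"
      unfolding field_differentiable_def has_field_derivative_def by blast
    moreover have "bounded_clinear ((*) c)"
      by (simp add: bounded_clinear_complex_iff bounded_linear_mult_right scaleC_complex_def)
    ultimately show "\<exists>f'. bounded_clinear f' \<and> (f has_derivative f') (at x)"
      by blast
  qed
  then show ?thesis
    by (auto simp: holomorphic_maps_def holomorphic_on_open[OF assms] field_differentiable_def)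
qed

end

theory Submission
  imports Defs "HOL-Library.Function_Algebras" "HOL-Complex_Analysis.Riemann_Mapping"
begin

text \<open>
  Let \<open>s\<close> be the supremum of \<open>\<bar>f w\<bar>\<close> over the holomorphic \<open>f\<close> from the ball \<open>B\<close> to the disc with
  \<open>f z = 0\<close>, and let \<open>f\<close> be a maximizing sequence. By Hahn--Banach the functional \<open>g \<mapsto> g w / s\<close>
  on the functions vanishing at \<open>z\<close> extends to a functional of norm 1 on the bounded functions;
  since it attains its norm at \<open>f\<close>, it is \<open>cnj f\<close> times a state \<open>M\<close> that lives where \<open>f\<close> is
  unimodular and whose image under \<open>f\<close> is the Poisson measure of \<open>s\<close>. Integrating a linear
  functional against \<open>M\<close> weighted by a quotient of Poisson kernels of \<open>u\<close> and \<open>s\<close> at \<open>f\<close> gives a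
  point of the ball of the bidual that depends holomorphically on \<open>u\<close>, equals \<open>z\<close> for \<open>u = 0\<close> and
  \<open>w\<close> for \<open>u = s\<close>. Projecting it to \<open>X\<close> gives a disc on which \<open>f\<close> is asymptotically a left
  inverse, hence a complex geodesic. Working with the sequence \<open>f\<close>, as a function on
  \<open>nat \<times> B\<close>, avoids the existence of an extremal function.
\<close>

subsection \<open>The Hahn--Banach theorem\<close>

text \<open>In infinite dimensions a sequence of discs in the ball need not have a convergent
  subsequence, so the extremal disc is not sought as a limit of discs. A point of the bidual,
  however, is only a functional on the dual of X, and integrating every linear functional against
  one fixed state produces such points without any compactness in X. The state need only be finitely
  additive, so no topology or measurability is imposed on \<open>nat \<times> B\<close>.

  The price is that the disc may leave X, where the functions of the sequence are no longer defined.
  This does no harm because only two points matter: the projection fixes z and w, so each function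
  of the sequence, composed with the projected disc, maps 0 to 0 and maps s to a value tending to s.
  Near equality in the Schwarz lemma at the single point s then spreads to the whole disc. Nothing
  has to be known about how the functions interact with the projection elsewhere.\<close>

lemma unimodular_rotation:
  obtains c where "cmod c = 1" "c * z = of_real (cmod z)"
proof (cases "z = 0")
  case False
  have "cnj z * z = complex_of_real (cmod z) * complex_of_real (cmod z)"
    using complex_norm_square[of z] by (simp add: power2_eq_square mult.commute)
  with False show ?thesis
    by (intro that[of "cnj z / cmod z"]) (simp_all add: norm_divide)
qed (use that[of 1] in simp)

text \<open>Scaling is asked only as an inequality, the form that infima inherit; using it for
  \<open>r\<close> and for its inverse recovers equality.\<close>

definition sublinear_on :: "'b::real_vector set \<Rightarrow> ('b \<Rightarrow> real) \<Rightarrow> bool"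
  where "sublinear_on V q \<longleftrightarrow>
    (\<forall>x\<in>V. \<forall>y\<in>V. q (x + y) \<le> q x + q y) \<and> (\<forall>r>0. \<forall>x\<in>V. q (r *\<^sub>R x) \<le> r * q x)"

lemma sublinear_on_zero:
  assumes "sublinear_on V q" "subspace V"
  shows "q 0 = 0"
proof -
  have "q (2 *\<^sub>R 0) \<le> 2 * q 0" "q ((1/2) *\<^sub>R 0) \<le> (1/2) * q 0"
    using assms(1) subspace_0[OF assms(2)] unfolding sublinear_on_def
    by (metis half_gt_zero_iff zero_less_numeral zero_less_one)+
  then show ?thesis by simp
qed

lemma sublinear_on_minus:
  assumes "sublinear_on V q" "subspace V" "x \<in> V"
  shows "- q (- x) \<le> q x"
proof -
  have "q (x + - x) \<le> q x + q (- x)"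
    using assms unfolding sublinear_on_def by (meson subspace_neg)
  then show ?thesis using sublinear_on_zero[OF assms(1,2)] by simp
qed

text \<open>Serves three infima: over a chain, over the shifts along one direction, and over the
  subspace from which a functional is extended. The lower bound \<open>b\<close> makes each real
  infimum a genuine one.\<close>

lemma sublinear_on_Inf:
  fixes a :: "'i \<Rightarrow> 'b::real_vector \<Rightarrow> real"
  assumes V: "subspace V" and I: "I \<noteq> {}"
    and bd: "\<And>i x. i \<in> I \<Longrightarrow> x \<in> V \<Longrightarrow> b x \<le> a i x"
    and add: "\<And>i j x y. i \<in> I \<Longrightarrow> j \<in> I \<Longrightarrow> x \<in> V \<Longrightarrow> y \<in> V \<Longrightarrow> \<exists>k\<in>I. a k (x + y) \<le> a i x + a j y"
    and scale: "\<And>i r x. i \<in> I \<Longrightarrow> r > 0 \<Longrightarrow> x \<in> V \<Longrightarrow> \<exists>k\<in>I. a k (r *\<^sub>R x) \<le> r * a i x"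
  shows "sublinear_on V (\<lambda>x. INF i\<in>I. a i x)"
    and "\<And>i x. i \<in> I \<Longrightarrow> x \<in> V \<Longrightarrow> (INF i\<in>I. a i x) \<le> a i x"
proof -
  show le: "(INF i\<in>I. a i x) \<le> a i x" if "i \<in> I" "x \<in> V" for i x
    using bd that by (intro cINF_lower) (auto intro!: bdd_belowI)
  show "sublinear_on V (\<lambda>x. INF i\<in>I. a i x)"
    unfolding sublinear_on_def
  proof (intro conjI ballI allI impI)
    fix x y assume x: "x \<in> V" and y: "y \<in> V"
    have "(INF i\<in>I. a i (x + y)) - a j y \<le> (INF i\<in>I. a i x)" if j: "j \<in> I" for j
    proof (rule cINF_greatest[OF I])
      fix i assume i: "i \<in> I"
      obtain k where "k \<in> I" "a k (x + y) \<le> a i x + a j y"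
        using add[OF i j x y] by blast
      with le[of k "x + y"] V x y show "(INF i\<in>I. a i (x + y)) - a j y \<le> a i x"
        by (force simp: subspace_add)
    qed
    then have "(INF i\<in>I. a i (x + y)) - (INF i\<in>I. a i x) \<le> (INF i\<in>I. a i y)"
      by (intro cINF_greatest[OF I]) (simp add: algebra_simps)
    then show "(INF i\<in>I. a i (x + y)) \<le> (INF i\<in>I. a i x) + (INF i\<in>I. a i y)"
      by simp
  next
    fix r :: real and x assume r: "0 < r" and x: "x \<in> V"
    have "(INF i\<in>I. a i (r *\<^sub>R x)) / r \<le> (INF i\<in>I. a i x)"
    proof (rule cINF_greatest[OF I])
      fix i assume i: "i \<in> I"
      obtain k where "k \<in> I" "a k (r *\<^sub>R x) \<le> r * a i x"
        using scale[OF i r x] by blast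
      with le[of k "r *\<^sub>R x"] V x r show "(INF i\<in>I. a i (r *\<^sub>R x)) / r \<le> a i x"
        by (force simp: subspace_scale divide_simps mult.commute)
    qed
    then show "(INF i\<in>I. a i (r *\<^sub>R x)) \<le> r * (INF i\<in>I. a i x)"
      using r by (simp add: divide_simps mult.commute)
  qed
qed

text \<open>
  A minimal sublinear functional \<open>q\<close> is linear: it is not decreased by passing to
  \<open>y \<mapsto> inf {q (y + t x) - t q x | t \<ge> 0}\<close>, which gives superadditivity.
\<close>

lemma sublinear_dominates_linear:
  fixes p :: "'b::real_vector \<Rightarrow> real"
  assumes V: "subspace V" and p: "sublinear_on V p"
  obtains F :: "'b \<Rightarrow> real" where
    "\<And>x y. x \<in> V \<Longrightarrow> y \<in> V \<Longrightarrow> F (x + y) = F x + F y"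
    "\<And>r x. x \<in> V \<Longrightarrow> F (r *\<^sub>R x) = r * F x"
    "\<And>x. x \<in> V \<Longrightarrow> F x \<le> p x"
proof -
  \<comment> \<open>The value 0 off \<open>V\<close> makes functionals that agree on
    \<open>V\<close> equal, so minimality is an equality of functions. \<open>P\<close> is the
    reversed pointwise order: chains need lower bounds, and Zorn yields a minimal element.\<close>
  define S where "S = {q. sublinear_on V q \<and> (\<forall>x. x \<notin> V \<longrightarrow> q x = 0) \<and> (\<forall>x\<in>V. q x \<le> p x)}"
  define P where "P = (\<lambda>(q :: 'b \<Rightarrow> real) r. \<forall>x. r x \<le> (q x :: real))"
  define cut where "cut = (\<lambda>q (x::'b). if x \<in> V then q x else (0::real))"
  have cut: "cut q \<in> S" if "sublinear_on V q" "\<And>x. x \<in> V \<Longrightarrow> q x \<le> p x" for q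
    using that V unfolding S_def cut_def sublinear_on_def
    by (auto simp: subspace_add subspace_scale)
  have "\<exists>m\<in>S. \<forall>a\<in>S. P m a \<longrightarrow> a = m"
  proof (rule predicate_Zorn)
    show "partial_order_on S (relation_of P S)"
      by (rule partial_order_on_relation_ofI)
        (auto simp: P_def fun_eq_iff intro: order_trans antisym)
  next
    fix C assume C: "C \<in> Chains (relation_of P S)"
    then have CS: "C \<subseteq> S" and tot: "\<And>q r. q \<in> C \<Longrightarrow> r \<in> C \<Longrightarrow> P q r \<or> P r q"
      unfolding Chains_def relation_of_def by auto
    show "\<exists>u\<in>S. \<forall>a\<in>C. P a u"
    proof (cases "C = {}")
      case True
      then show ?thesis using cut[OF p] by auto
    next
      case False
      define u where "u = (\<lambda>x. INF q\<in>C. q x)"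
      have 1: "sublinear_on V u" and 2: "\<And>q x. q \<in> C \<Longrightarrow> x \<in> V \<Longrightarrow> u x \<le> q x"
        unfolding u_def
      proof (atomize(full), intro conjI allI impI, goal_cases)
        case 1
        \<comment> \<open>Every \<open>q \<le> p\<close> satisfies
          \<open>q x \<ge> - q (- x) \<ge> - p (- x)\<close>, a bound uniform over the
          chain.\<close>
        show ?case
        proof (rule sublinear_on_Inf(1)[OF V False, where b = "\<lambda>x. - p (- x)"])
          fix q x assume q: "q \<in> C" and x: "x \<in> V"
          have "- q (- x) \<le> q x" "q (- x) \<le> p (- x)"
            using q CS x sublinear_on_minus[OF _ V] V by (auto simp: S_def subspace_neg)
          then show "- p (- x) \<le> q x" by simp
        next
          fix q r x y assume q: "q \<in> C" and r: "r \<in> C" and x: "x \<in> V" and y: "y \<in> V"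
          have "q (x + y) \<le> q x + q y" "r (x + y) \<le> r x + r y"
            using q r CS x y by (auto simp: S_def sublinear_on_def)
          then show "\<exists>k\<in>C. k (x + y) \<le> q x + r y"
            using tot[OF q r] q r unfolding P_def by (meson add_mono order.refl order_trans)
        next
          fix q x and r :: real assume "q \<in> C" "0 < r" "x \<in> V"
          then show "\<exists>k\<in>C. k (r *\<^sub>R x) \<le> r * q x"
            using CS by (intro bexI[of _ q]) (auto simp: S_def sublinear_on_def)
        qed
      next
        case (2 q x)
        have "- p (- x) \<le> r x" if "r \<in> C" for r
        proof -
          have "- r (- x) \<le> r x" "r (- x) \<le> p (- x)"
            using that CS 2 sublinear_on_minus[OF _ V] V by (auto simp: S_def subspace_neg)
          then show ?thesis by simp
        qed
        then show ?case
          using 2 by (intro cINF_lower) (auto intro!: bdd_belowI)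
      qed
      obtain q where "q \<in> C" using False by auto
      then have "u x \<le> p x" if "x \<in> V" for x
        using 2[of q x] that CS unfolding S_def by force
      then have "cut u \<in> S" using cut[OF 1] by blast
      moreover have "P a (cut u)" if "a \<in> C" for a
        using that 2 CS unfolding P_def cut_def S_def by auto
      ultimately show ?thesis by blast
    qed
  qed
  then obtain q where q: "q \<in> S" and min: "\<And>a. a \<in> S \<Longrightarrow> P q a \<Longrightarrow> a = q" by blast
  have sub: "sublinear_on V q" and qp: "\<And>x. x \<in> V \<Longrightarrow> q x \<le> p x"
    using q by (auto simp: S_def)
  have q0: "q 0 = 0" by (rule sublinear_on_zero[OF sub V])
  have qa: "q (x + y) \<le> q x + q y" if "x \<in> V" "y \<in> V" for x y
    using sub that by (auto simp: sublinear_on_def)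
  have qs: "q (r *\<^sub>R x) = r * q x" if "x \<in> V" "r \<ge> 0" for x r
  proof (cases "r = 0")
    case False
    then have r: "r > 0" using that by simp
    then have "q (r *\<^sub>R x) \<le> r * q x" "q (inverse r *\<^sub>R (r *\<^sub>R x)) \<le> inverse r * q (r *\<^sub>R x)"
      using sub that V unfolding sublinear_on_def by (meson positive_imp_inverse_positive subspace_scale)+
    with r show ?thesis by (simp add: field_simps)
  qed (simp add: q0)
  have add: "q (x + y) = q x + q y" if x: "x \<in> V" and y: "y \<in> V" for x y
  proof -
    define a where "a = (\<lambda>t y. q (y + t *\<^sub>R x) - t * q x)"
    define u where "u = (\<lambda>y. INF t\<in>{0..}. a t y)"
    have *: "sublinear_on V u \<and> (\<forall>t y. t \<in> {0..} \<longrightarrow> y \<in> V \<longrightarrow> u y \<le> a t y)"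
      unfolding u_def
    proof (intro conjI allI impI sublinear_on_Inf(1)[OF V] sublinear_on_Inf(2)[OF V])
      fix t y assume t: "t \<in> {0::real..}" and y: "y \<in> V"
      have "q (t *\<^sub>R x) \<le> q (y + t *\<^sub>R x) + q (- y)"
        using qa[of "y + t *\<^sub>R x" "- y"] x y V by (simp add: subspace_add subspace_scale subspace_neg)
      then show "- q (- y) \<le> a t y" "- q (- y) \<le> a t y"
        using t x by (auto simp: a_def qs)
    next
      fix t t' y y' assume "t \<in> {0::real..}" "t' \<in> {0::real..}" "y \<in> V" "y' \<in> V"
      then have "a (t + t') (y + y') \<le> a t y + a t' y'" "t + t' \<in> {0..}"
        using qa[of "y + t *\<^sub>R x" "y' + t' *\<^sub>R x"] x V
        by (auto simp: a_def algebra_simps subspace_add subspace_scale)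
      then show "\<exists>k\<in>{0..}. a k (y + y') \<le> a t y + a t' y'"
         "\<exists>k\<in>{0..}. a k (y + y') \<le> a t y + a t' y'" by blast+
    next
      fix t y and r :: real assume "t \<in> {0::real..}" "y \<in> V" "0 < r"
      then have "a (r * t) (r *\<^sub>R y) \<le> r * a t y" "r * t \<in> {0..}"
        using qs[of "y + t *\<^sub>R x" r] x V
        by (auto simp: a_def algebra_simps subspace_add subspace_scale)
      then show "\<exists>k\<in>{0..}. a k (r *\<^sub>R y) \<le> r * a t y" "\<exists>k\<in>{0..}. a k (r *\<^sub>R y) \<le> r * a t y"
        by blast+
    qed auto
    have uq: "u y \<le> q y" if "y \<in> V" for y
      using *[THEN conjunct2, rule_format, of 0 y] that by (simp add: a_def)
    have "cut u \<in> S"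
    proof (rule cut)
      show "sublinear_on V u" using * by blast
      show "u y \<le> p y" if "y \<in> V" for y
        using uq[OF that] qp[OF that] by simp
    qed
    moreover have "P q (cut u)"
      using uq q unfolding P_def cut_def S_def by auto
    ultimately have "cut u = q" by (rule min)
    then have "q y = u y" using y unfolding cut_def by meson
    also have "u y \<le> a 1 y" using * y by simp
    finally have "q y \<le> a 1 y" .
    then show ?thesis using qa[OF x y] by (simp add: a_def add.commute)
  qed
  have neg: "q (- x) = - q x" if "x \<in> V" for x
    using add[of x "- x"] that V q0 by (simp add: subspace_neg)
  have "q (r *\<^sub>R x) = r * q x" if "x \<in> V" for r x
  proof (cases "r \<ge> 0")
    case False
    then have "q ((- r) *\<^sub>R x) = - r * q x" using qs[OF that, of "- r"] by simp
    then show ?thesis using neg[of "r *\<^sub>R x"] V that by (simp add: subspace_scale)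
  qed (use qs that in auto)
  then show ?thesis using that[of q] add qp by blast
qed

text \<open>Infimal convolution: \<open>inf {p (x - w) + L w | w \<in> W}\<close> is sublinear, at
  most \<open>p\<close> (take \<open>w = 0\<close>) and at most \<open>L\<close> on \<open>W\<close>
  (take \<open>w = x\<close>). A linear functional below it satisfies \<open>F \<le> L\<close> on
  \<open>W\<close>, and evaluating at \<open>- w\<close> turns this into equality.\<close>

lemma hahn_banach_real:
  fixes p :: "'b::real_vector \<Rightarrow> real"
  assumes V: "subspace V" and p: "sublinear_on V p" and W: "subspace W" "W \<subseteq> V"
    and Ladd: "\<And>x y. x \<in> W \<Longrightarrow> y \<in> W \<Longrightarrow> L (x + y) = L x + L y"
    and Lscale: "\<And>r x. x \<in> W \<Longrightarrow> L (r *\<^sub>R x) = r * L x"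
    and Lp: "\<And>x. x \<in> W \<Longrightarrow> L x \<le> p x"
  obtains F :: "'b \<Rightarrow> real" where
    "\<And>x y. x \<in> V \<Longrightarrow> y \<in> V \<Longrightarrow> F (x + y) = F x + F y"
    "\<And>r x. x \<in> V \<Longrightarrow> F (r *\<^sub>R x) = r * F x"
    "\<And>x. x \<in> V \<Longrightarrow> F x \<le> p x"
    "\<And>x. x \<in> W \<Longrightarrow> F x = L x"
proof -
  define a where "a = (\<lambda>w x. p (x - w) + L w)"
  define u where "u = (\<lambda>x. INF w\<in>W. a w x)"
  have padd: "p (x + y) \<le> p x + p y" if "x \<in> V" "y \<in> V" for x y
    using p that by (auto simp: sublinear_on_def)
  have Lneg: "L (- w) = - L w" if "w \<in> W" for w
    using Lscale[of w "-1"] that by simp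
  have bd: "- p (- x) \<le> a w x" if w: "w \<in> W" and x: "x \<in> V" for w x
    using padd[of "x - w" "- x"] Lp[of "- w"] Lneg[OF w] w x W V
    by (auto simp: a_def subspace_neg subspace_diff subset_iff)
  have ad: "\<exists>k\<in>W. a k (x + y) \<le> a i x + a j y"
    if "i \<in> W" "j \<in> W" "x \<in> V" "y \<in> V" for i j x y
    using that padd[of "x - i" "y - j"] W V
    by (intro bexI[of _ "i + j"])
      (auto simp: a_def Ladd subspace_add subspace_diff subset_iff algebra_simps)
  have sc: "\<exists>k\<in>W. a k (r *\<^sub>R x) \<le> r * a i x" if "i \<in> W" "0 < r" "x \<in> V" for i r x
  proof (intro bexI[of _ "r *\<^sub>R i"])
    have "p (r *\<^sub>R (x - i)) \<le> r * p (x - i)"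
      using p that W V unfolding sublinear_on_def by (meson subsetD subspace_diff)
    then show "a (r *\<^sub>R i) (r *\<^sub>R x) \<le> r * a i x"
      using that by (simp add: a_def Lscale algebra_simps)
  qed (use that W in \<open>simp add: subspace_scale\<close>)
  have W0: "W \<noteq> {}" using W subspace_0 by auto
  have u: "sublinear_on V u"
    unfolding u_def by (rule sublinear_on_Inf(1)[OF V W0]) (fact bd ad sc)+
  have ule: "u x \<le> a w x" if "w \<in> W" "x \<in> V" for w x
    unfolding u_def by (rule sublinear_on_Inf(2)[OF V W0]) (fact bd ad sc that)+
  obtain F where F: "\<And>x y. x \<in> V \<Longrightarrow> y \<in> V \<Longrightarrow> F (x + y) = F x + F y"
    "\<And>r x. x \<in> V \<Longrightarrow> F (r *\<^sub>R x) = r * F x" "\<And>x. x \<in> V \<Longrightarrow> F x \<le> u x"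
    using sublinear_dominates_linear[OF V u] by blast
  have L0: "L 0 = 0" using Lscale[of 0 0] subspace_0[OF W(1)] by simp
  have p0: "p 0 = 0" by (rule sublinear_on_zero[OF p V])
  have FL: "F w \<le> L w" if "w \<in> W" for w
    using F(3)[of w] ule[of w w] that W(2) by (simp add: a_def p0 subset_iff)
  have "F w = L w" if "w \<in> W" for w
  proof -
    have w: "- w \<in> W" "w \<in> V" using that W subspace_neg by blast+
    show ?thesis
      using FL[OF that] FL[OF w(1)] F(2)[OF w(2), of "- 1"] Lneg[OF that] by simp
  qed
  moreover have "F x \<le> p x" if "x \<in> V" for x
    using F(3)[OF that] ule[OF subspace_0[OF W(1)] that] by (simp add: a_def L0)
  ultimately show ?thesis using that[of F] F(1,2) by blast
qed

text \<open>
  The complex scalar multiplication is a parameter so that the result applies both to complex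
  normed spaces and to spaces of functions with the supremum seminorm.
\<close>

lemma hahn_banach_complex:
  fixes p :: "'b::real_vector \<Rightarrow> real" and sc :: "complex \<Rightarrow> 'b \<Rightarrow> 'b"
  assumes sc: "vector_space sc" and sc_real: "\<And>r x. sc (complex_of_real r) x = r *\<^sub>R x"
    and V: "module.subspace sc V" and W: "module.subspace sc W" "W \<subseteq> V"
    and padd: "\<And>x y. x \<in> V \<Longrightarrow> y \<in> V \<Longrightarrow> p (x + y) \<le> p x + p y"
    and psc: "\<And>c x. x \<in> V \<Longrightarrow> p (sc c x) = cmod c * p x"
    and Ladd: "\<And>x y. x \<in> W \<Longrightarrow> y \<in> W \<Longrightarrow> L (x + y) = L x + L y"
    and Lsc: "\<And>c x. x \<in> W \<Longrightarrow> L (sc c x) = c * L x"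
    and Lp: "\<And>x. x \<in> W \<Longrightarrow> cmod (L x) \<le> p x"
  obtains F :: "'b \<Rightarrow> complex" where
    "\<And>x y. x \<in> V \<Longrightarrow> y \<in> V \<Longrightarrow> F (x + y) = F x + F y"
    "\<And>c x. x \<in> V \<Longrightarrow> F (sc c x) = c * F x"
    "\<And>x. x \<in> V \<Longrightarrow> cmod (F x) \<le> p x"
    "\<And>x. x \<in> W \<Longrightarrow> F x = L x"
proof -
  interpret vector_space sc by (rule sc)
  have real_sub: "Real_Vector_Spaces.subspace U" if "subspace U" for U
    using that unfolding Real_Vector_Spaces.subspace_def subspace_def by (metis sc_real)
  have psub: "sublinear_on V p"
    unfolding sublinear_on_def using padd psc by (metis sc_real abs_of_pos norm_of_real order.refl)
  have 1: "Re (L (r *\<^sub>R x)) = r * Re (L x)" if "x \<in> W" for r x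
    using Lsc[OF that, of "of_real r"] by (simp add: sc_real)
  have 2: "Re (L x) \<le> p x" if "x \<in> W" for x
    using Lp[OF that] complex_Re_le_cmod order_trans by blast
  obtain G where Gadd: "\<And>x y. x \<in> V \<Longrightarrow> y \<in> V \<Longrightarrow> G (x + y) = G x + G y"
    and Gsc: "\<And>r x. x \<in> V \<Longrightarrow> G (r *\<^sub>R x) = r * G x"
    and Gp: "\<And>x. x \<in> V \<Longrightarrow> G x \<le> p x" and GL: "\<And>x. x \<in> W \<Longrightarrow> G x = Re (L x)"
    by (rule hahn_banach_real[OF real_sub[OF V] psub real_sub[OF W(1)] W(2), of "\<lambda>x. Re (L x)"])
      (use Ladd 1 2 in auto)
  \<comment> \<open>A complex linear functional is determined by its real part, since
    \<open>Im (F x) = - Re (F (\<i> x))\<close>.\<close>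
  define F where "F = (\<lambda>x. Complex (G x) (- G (sc \<i> x)))"
  have Fadd: "F (x + y) = F x + F y" if "x \<in> V" "y \<in> V" for x y
    using that V by (simp add: F_def complex_eq_iff Gadd scale_right_distrib subspace_scale)
  have Fsc: "F (sc c x) = c * F x" if x: "x \<in> V" for c x
  proof -
    have V': "sc d x \<in> V" for d using V x by (rule subspace_scale)
    have G: "G (sc d x) = Re d * G x + Im d * G (sc \<i> x)" for d
    proof -
      have "sc d x = Re d *\<^sub>R x + Im d *\<^sub>R sc \<i> x"
        by (subst complex_eq[of d]) (simp only: scale_left_distrib sc_real[symmetric] scale_scale mult.commute)
      then show ?thesis
        using x V' V by (metis Gadd Gsc sc_real subspace_scale)
    qed
    show ?thesis
      using G[of c] G[of "\<i> * c"] by (simp add: F_def complex_eq_iff algebra_simps)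
  qed
  have "cmod (F x) \<le> p x" if x: "x \<in> V" for x
  proof -
    obtain c where c: "cmod c = 1" and "c * F x = of_real (cmod (F x))"
      by (rule unimodular_rotation)
    then have "F (sc c x) = of_real (cmod (F x))" using Fsc[OF x] by simp
    then have "cmod (F x) = G (sc c x)" by (simp add: F_def complex_eq_iff)
    also have "\<dots> \<le> p (sc c x)" using V x by (intro Gp subspace_scale)
    finally show ?thesis using psc[OF x] c by simp
  qed
  moreover have "F x = L x" if "x \<in> W" for x
    using GL[OF that] GL[OF subspace_scale[OF W(1) that, of \<i>]] Lsc[OF that, of \<i>]
    by (simp add: F_def complex_eq_iff)
  ultimately show ?thesis by (intro that[of F] Fadd Fsc)
qed

subsection \<open>States on bounded functions\<close>

instantiation "fun" :: (type, real_vector) real_vector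
begin

definition scaleR_fun :: "real \<Rightarrow> ('a \<Rightarrow> 'b) \<Rightarrow> 'a \<Rightarrow> 'b"
  where "scaleR_fun r f = (\<lambda>x. r *\<^sub>R f x)"

instance
  by standard (simp_all add: scaleR_fun_def fun_eq_iff algebra_simps)

end

definition bounded_fun :: "('i \<Rightarrow> complex) \<Rightarrow> bool"
  where "bounded_fun h \<longleftrightarrow> (\<exists>C. \<forall>\<omega>. cmod (h \<omega>) \<le> C)"

lemma bounded_funI: "(\<And>\<omega>. cmod (h \<omega>) \<le> C) \<Longrightarrow> bounded_fun h"
  by (auto simp: bounded_fun_def)

lemma bounded_funE:
  assumes "bounded_fun h"
  obtains C where "C > 0" "\<And>\<omega>. cmod (h \<omega>) \<le> C"
proof -
  obtain C where "\<And>\<omega>. cmod (h \<omega>) \<le> C" using assms by (auto simp: bounded_fun_def)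
  then have "\<And>\<omega>. cmod (h \<omega>) \<le> max C 1" by (simp add: le_max_iff_disj)
  then show ?thesis using that[of "max C 1"] by simp
qed

named_theorems bounded_fun_intros

lemma bounded_fun_const [bounded_fun_intros]: "bounded_fun (\<lambda>_. c)"
  by (auto simp: bounded_fun_def)

lemma bounded_fun_add [bounded_fun_intros]:
  assumes "bounded_fun g" "bounded_fun h"
  shows "bounded_fun (\<lambda>\<omega>. g \<omega> + h \<omega>)"
proof -
  obtain C D where "\<And>\<omega>. cmod (g \<omega>) \<le> C" "\<And>\<omega>. cmod (h \<omega>) \<le> D"
    using assms by (auto simp: bounded_fun_def)
  then show ?thesis by (intro bounded_funI[of _ "C + D"]) (meson add_mono norm_triangle_le)
qed

lemma bounded_fun_mult [bounded_fun_intros]: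
  assumes "bounded_fun g" "bounded_fun h"
  shows "bounded_fun (\<lambda>\<omega>. g \<omega> * h \<omega>)"
proof -
  obtain C D where "C > 0" "\<And>\<omega>. cmod (g \<omega>) \<le> C" "D > 0" "\<And>\<omega>. cmod (h \<omega>) \<le> D"
    using assms by (metis bounded_funE)
  then show ?thesis
    by (intro bounded_funI[of _ "C * D"]) (simp add: norm_mult mult_mono)
qed

lemma bounded_fun_cnj [bounded_fun_intros]: "bounded_fun g \<Longrightarrow> bounded_fun (\<lambda>\<omega>. cnj (g \<omega>))"
  by (simp add: bounded_fun_def)

lemma bounded_fun_diff [bounded_fun_intros]:
  assumes "bounded_fun g" "bounded_fun h"
  shows "bounded_fun (\<lambda>\<omega>. g \<omega> - h \<omega>)"
  using bounded_fun_add[OF assms(1) bounded_fun_mult[OF bounded_fun_const[of "-1"] assms(2)]] by simp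

lemma bounded_fun_power [bounded_fun_intros]: "bounded_fun g \<Longrightarrow> bounded_fun (\<lambda>\<omega>. g \<omega> ^ n)"
  by (induction n) (auto intro: bounded_fun_intros)

text \<open>The unit ball of the dual of the bounded functions. Stating the norm bound through
  pointwise bounds avoids a normed type of bounded functions; values at unbounded arguments are left
  open.\<close>

locale contractive_functional =
  fixes M :: "('i \<Rightarrow> complex) \<Rightarrow> complex"
  assumes add: "bounded_fun g \<Longrightarrow> bounded_fun h \<Longrightarrow> M (\<lambda>\<omega>. g \<omega> + h \<omega>) = M g + M h"
    and cmult: "bounded_fun g \<Longrightarrow> M (\<lambda>\<omega>. c * g \<omega>) = c * M g"
    and norm_le: "(\<And>\<omega>. cmod (g \<omega>) \<le> C) \<Longrightarrow> cmod (M g) \<le> C"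
begin

lemma diff:
  assumes "bounded_fun g" "bounded_fun h"
  shows "M (\<lambda>\<omega>. g \<omega> - h \<omega>) = M g - M h"
proof -
  have "M (\<lambda>\<omega>. g \<omega> + - 1 * h \<omega>) = M g + - 1 * M h"
    using assms by (simp only: add cmult bounded_fun_intros)
  then show ?thesis by simp
qed

lemma cmult': "bounded_fun g \<Longrightarrow> M (\<lambda>\<omega>. g \<omega> * c) = M g * c"
  using cmult[of g c] by (simp add: mult.commute)

lemma divide: "bounded_fun g \<Longrightarrow> M (\<lambda>\<omega>. g \<omega> / c) = M g / c"
  using cmult'[of g "inverse c"] by (simp add: divide_inverse)

end

text \<open>A contraction that attains its norm at 1 is automatically real and positive, so it is a
  finitely additive probability measure; positivity is derived below rather than assumed.\<close>

locale state = contractive_functional +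
  assumes unital: "M (\<lambda>_. 1) = 1"
begin

lemma const: "M (\<lambda>_. c) = c"
  using cmult[OF bounded_fun_const[of 1], of c] unital by simp

lemma Im_eq_0:
  assumes "bounded_fun (\<lambda>\<omega>. of_real (h \<omega>))"
  shows "Im (M (\<lambda>\<omega>. of_real (h \<omega>))) = 0"
proof (rule ccontr)
  define b where "b = Im (M (\<lambda>\<omega>. of_real (h \<omega>)))"
  assume "Im (M (\<lambda>\<omega>. of_real (h \<omega>))) \<noteq> 0"
  then have b: "b \<noteq> 0" by (simp add: b_def)
  obtain C where C: "C > 0" "\<And>\<omega>. \<bar>h \<omega>\<bar> \<le> C"
    using assms by (auto elim: bounded_funE)
  \<comment> \<open>Contractivity gives \<open>(b + t)^2 \<le> C^2 + t^2\<close>, that is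
    \<open>b^2 + 2 b t \<le> C^2\<close>, for every real \<open>t\<close>; with
    \<open>b t = C^2\<close> this becomes absurd.\<close>
  define t where "t = C\<^sup>2 / b"
  have "cmod (of_real (h \<omega>) + \<i> * of_real t) \<le> sqrt (C\<^sup>2 + t\<^sup>2)" for \<omega>
    using C by (simp add: cmod_def power2_le_iff_abs_le)
  then have "cmod (M (\<lambda>\<omega>. of_real (h \<omega>) + \<i> * of_real t)) \<le> sqrt (C\<^sup>2 + t\<^sup>2)"
    by (rule norm_le)
  moreover have "M (\<lambda>\<omega>. of_real (h \<omega>) + \<i> * of_real t) = M (\<lambda>\<omega>. of_real (h \<omega>)) + \<i> * of_real t"
    using assms by (simp add: add bounded_fun_intros const)
  ultimately have "\<bar>Im (M (\<lambda>\<omega>. of_real (h \<omega>)) + \<i> * of_real t)\<bar> \<le> sqrt (C\<^sup>2 + t\<^sup>2)"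
    by (metis abs_Im_le_cmod order_trans)
  then have "\<bar>b + t\<bar> \<le> sqrt (C\<^sup>2 + t\<^sup>2)"
    by (simp add: b_def)
  then have "(b + t)\<^sup>2 \<le> C\<^sup>2 + t\<^sup>2"
    by (metis real_sqrt_abs real_sqrt_le_iff)
  moreover have "b * t = C\<^sup>2" using b by (simp add: t_def)
  ultimately have "b\<^sup>2 + C\<^sup>2 \<le> 0" by (simp add: power2_sum)
  with b show False by (smt (verit) zero_less_power2 zero_le_power2)
qed

text \<open>If \<open>0 \<le> h \<le> C\<close> pointwise then \<open>|C - h| \<le> C\<close>, so
  contractivity forces \<open>C - Re (M h) \<le> C\<close>.\<close>

lemma nonneg:
  assumes b: "bounded_fun (\<lambda>\<omega>. of_real (h \<omega>))" and h: "\<And>\<omega>. h \<omega> \<ge> 0"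
  shows "Re (M (\<lambda>\<omega>. of_real (h \<omega>))) \<ge> 0"
proof -
  obtain C where C: "C > 0" "\<And>\<omega>. \<bar>h \<omega>\<bar> \<le> C"
    using b by (auto elim: bounded_funE)
  have "cmod (of_real C - of_real (h \<omega>)) \<le> C" for \<omega>
    unfolding of_real_diff[symmetric] norm_of_real using C(2)[of \<omega>] h[of \<omega>] by simp
  then have "cmod (M (\<lambda>\<omega>. of_real C - of_real (h \<omega>))) \<le> C" by (rule norm_le)
  moreover have "M (\<lambda>\<omega>. of_real C - of_real (h \<omega>)) = of_real C - M (\<lambda>\<omega>. of_real (h \<omega>))"
    using b by (simp add: diff bounded_fun_intros const)
  ultimately have "Re (of_real C - M (\<lambda>\<omega>. of_real (h \<omega>))) \<le> C"
    by (metis complex_Re_le_cmod order_trans)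
  then show ?thesis by simp
qed

lemma bounded_fun_Re_Im:
  assumes "bounded_fun g"
  shows "bounded_fun (\<lambda>\<omega>. of_real (Re (g \<omega>)))" "bounded_fun (\<lambda>\<omega>. of_real (Im (g \<omega>)))"
  using assms abs_Re_le_cmod abs_Im_le_cmod unfolding bounded_fun_def
  by (metis norm_of_real order_trans)+

lemma Re_eq:
  assumes g: "bounded_fun g"
  shows "Re (M (\<lambda>\<omega>. of_real (Re (g \<omega>)))) = Re (M g)"
    and "Re (M (\<lambda>\<omega>. of_real (Im (g \<omega>)))) = Im (M g)"
proof -
  have "M g = M (\<lambda>\<omega>. of_real (Re (g \<omega>)) + \<i> * of_real (Im (g \<omega>)))"
    by (simp add: complex_eq[symmetric])
  also have "\<dots> = M (\<lambda>\<omega>. of_real (Re (g \<omega>))) + \<i> * M (\<lambda>\<omega>. of_real (Im (g \<omega>)))"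
    by (simp add: add cmult bounded_fun_intros bounded_fun_Re_Im[OF g])
  finally show "Re (M (\<lambda>\<omega>. of_real (Re (g \<omega>)))) = Re (M g)"
    "Re (M (\<lambda>\<omega>. of_real (Im (g \<omega>)))) = Im (M g)"
    using Im_eq_0[OF bounded_fun_Re_Im(1)[OF g]] Im_eq_0[OF bounded_fun_Re_Im(2)[OF g]] by simp_all
qed

lemma cnj_eq:
  assumes g: "bounded_fun g"
  shows "M (\<lambda>\<omega>. cnj (g \<omega>)) = cnj (M g)"
proof -
  have *: "bounded_fun (\<lambda>\<omega>. cnj (g \<omega>))" using g by (rule bounded_fun_cnj)
  have "Im (M (\<lambda>\<omega>. cnj (g \<omega>))) = Re (M (\<lambda>\<omega>. - 1 * of_real (Im (g \<omega>))))"
    using Re_eq(2)[OF *] by simp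
  then have "Im (M (\<lambda>\<omega>. cnj (g \<omega>))) = - Im (M g)"
    using Re_eq(2)[OF g] cmult[OF bounded_fun_Re_Im(2)[OF g], of "-1"] by simp
  moreover have "Re (M (\<lambda>\<omega>. cnj (g \<omega>))) = Re (M g)"
    using Re_eq(1)[OF *] Re_eq(1)[OF g] by simp
  ultimately show ?thesis by (simp add: complex_eq_iff)
qed

text \<open>After rotating the value onto the positive axis by \<open>c\<close>, positivity applies
  to the nonnegative function \<open>C k - Re (c g) k\<close>.\<close>

lemma weighted_norm_le:
  assumes k: "bounded_fun (\<lambda>\<omega>. of_real (k \<omega>))" "\<And>\<omega>. k \<omega> \<ge> 0"
    and g: "\<And>\<omega>. cmod (g \<omega>) \<le> C"
  shows "cmod (M (\<lambda>\<omega>. g \<omega> * of_real (k \<omega>))) \<le> C * Re (M (\<lambda>\<omega>. of_real (k \<omega>)))"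
proof -
  have gb: "bounded_fun g" using g by (rule bounded_funI)
  obtain c where c: "cmod c = 1" "c * M (\<lambda>\<omega>. g \<omega> * of_real (k \<omega>)) = cmod (M (\<lambda>\<omega>. g \<omega> * of_real (k \<omega>)))"
    by (rule unimodular_rotation)
  have b: "bounded_fun (\<lambda>\<omega>. c * (g \<omega> * of_real (k \<omega>)))"
    by (intro bounded_fun_intros gb k)
  have b': "bounded_fun (\<lambda>\<omega>. of_real (Re (c * g \<omega>) * k \<omega>))"
    using bounded_fun_Re_Im(1)[OF b] by (simp add: algebra_simps)
  have Ck: "bounded_fun (\<lambda>\<omega>. of_real (C * k \<omega>))"
    using bounded_fun_mult[OF bounded_fun_const k(1), of "of_real C"] by simp
  have Ckg: "bounded_fun (\<lambda>\<omega>. of_real (C * k \<omega> - Re (c * g \<omega>) * k \<omega>))"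
    unfolding of_real_diff by (intro bounded_fun_diff Ck b')
  have "Re (c * g \<omega>) \<le> C" for \<omega>
    using g[of \<omega>] complex_Re_le_cmod[of "c * g \<omega>"] by (simp add: norm_mult c)
  then have "C * k \<omega> - Re (c * g \<omega>) * k \<omega> \<ge> 0" for \<omega>
    using k(2)[of \<omega>] by (simp add: mult_right_mono)
  then have "0 \<le> Re (M (\<lambda>\<omega>. of_real (C * k \<omega> - Re (c * g \<omega>) * k \<omega>)))"
    by (rule nonneg[OF Ckg])
  also have "\<dots> = Re (M (\<lambda>\<omega>. of_real (C * k \<omega>))) - Re (M (\<lambda>\<omega>. of_real (Re (c * g \<omega>) * k \<omega>)))"
    by (subst of_real_diff) (simp only: diff[OF Ck b'] minus_complex.sel)
  also have "Re (M (\<lambda>\<omega>. of_real (C * k \<omega>))) = C * Re (M (\<lambda>\<omega>. of_real (k \<omega>)))"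
    using cmult[OF k(1), of "of_real C"] by simp
  also have "Re (M (\<lambda>\<omega>. of_real (Re (c * g \<omega>) * k \<omega>))) = Re (M (\<lambda>\<omega>. c * (g \<omega> * of_real (k \<omega>))))"
    using Re_eq(1)[OF b] by (simp add: algebra_simps)
  also have "M (\<lambda>\<omega>. c * (g \<omega> * of_real (k \<omega>))) = cmod (M (\<lambda>\<omega>. g \<omega> * of_real (k \<omega>)))"
    using c(2) cmult[OF bounded_fun_mult[OF gb k(1)], of c] by simp
  finally show ?thesis by simp
qed

end

lemma hahn_banach_bounded_fun:
  fixes W :: "('i \<Rightarrow> complex) set"
  assumes W: "\<And>g. g \<in> W \<Longrightarrow> bounded_fun g" "(\<lambda>_. 0) \<in> W"
      "\<And>g h. g \<in> W \<Longrightarrow> h \<in> W \<Longrightarrow> (\<lambda>\<omega>. g \<omega> + h \<omega>) \<in> W"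
      "\<And>g c. g \<in> W \<Longrightarrow> (\<lambda>\<omega>. c * g \<omega>) \<in> W"
    and L: "\<And>g h. g \<in> W \<Longrightarrow> h \<in> W \<Longrightarrow> L (\<lambda>\<omega>. g \<omega> + h \<omega>) = L g + L h"
      "\<And>g c. g \<in> W \<Longrightarrow> L (\<lambda>\<omega>. c * g \<omega>) = c * L g"
      "\<And>g C. g \<in> W \<Longrightarrow> (\<And>\<omega>. cmod (g \<omega>) \<le> C) \<Longrightarrow> cmod (L g) \<le> C"
  obtains N where "contractive_functional N" "\<And>g. g \<in> W \<Longrightarrow> N g = L g"
proof -
  define sc :: "complex \<Rightarrow> ('i \<Rightarrow> complex) \<Rightarrow> 'i \<Rightarrow> complex" where "sc = (\<lambda>c g \<omega>. c * g \<omega>)"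
  \<comment> \<open>This supremum is a seminorm on bounded functions only; that is why the
    Hahn-Banach theorem carries the subspace \<open>V\<close>.\<close>
  define p :: "('i \<Rightarrow> complex) \<Rightarrow> real" where "p = (\<lambda>g. SUP \<omega>. cmod (g \<omega>))"
  have bdd: "bdd_above (range (\<lambda>\<omega>. cmod (g \<omega>)))" if "bounded_fun g" for g :: "'i \<Rightarrow> complex"
    using that unfolding bounded_fun_def bdd_above_def by blast
  have le_p: "cmod (g \<omega>) \<le> p g" if "bounded_fun g" for g \<omega>
    unfolding p_def by (intro cSUP_upper bdd that) simp
  have p_le: "p g \<le> C" if "\<And>\<omega>. cmod (g \<omega>) \<le> C" for g C
    unfolding p_def by (intro cSUP_least that) simp
  interpret vector_space sc
    by standard (simp_all add: sc_def fun_eq_iff algebra_simps)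
  have le: "p (sc c g) \<le> cmod c * p g" if "bounded_fun g" for c g
    using le_p[OF that] by (intro p_le) (simp add: sc_def norm_mult mult_left_mono)
  have psc: "p (sc c g) = cmod c * p g" if g: "g \<in> Collect bounded_fun" for c g
  proof (cases "c = 0")
    case True
    then show ?thesis by (simp add: p_def sc_def)
  next
    case False
    have "bounded_fun (sc c g)" using g by (auto simp: sc_def intro: bounded_fun_intros)
    from le[OF this, of "inverse c"] have "p g \<le> inverse (cmod c) * p (sc c g)"
      using False by (simp add: sc_def norm_inverse mult.assoc[symmetric])
    with le[of g c] g False show ?thesis by (simp add: field_simps)
  qed
  have subV: "subspace (Collect bounded_fun)"
    unfolding subspace_def
    by (auto simp: sc_def plus_fun_def zero_fun_def intro: bounded_fun_intros)
  have subW: "subspace W"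
    unfolding subspace_def using W by (auto simp: sc_def plus_fun_def zero_fun_def)
  have sub: "W \<subseteq> Collect bounded_fun" using W(1) by auto
  obtain F :: "('i \<Rightarrow> complex) \<Rightarrow> complex" where
    F: "\<And>x y. x \<in> Collect bounded_fun \<Longrightarrow> y \<in> Collect bounded_fun \<Longrightarrow> F (x + y) = F x + F y"
    "\<And>c x. x \<in> Collect bounded_fun \<Longrightarrow> F (sc c x) = c * F x"
    "\<And>x. x \<in> Collect bounded_fun \<Longrightarrow> cmod (F x) \<le> p x"
    "\<And>x. x \<in> W \<Longrightarrow> F x = L x"
  proof (rule hahn_banach_complex[OF vector_space_axioms _ subV subW sub, of p L])
    show "sc (complex_of_real r) x = r *\<^sub>R x" for r x
      by (simp add: sc_def scaleR_fun_def scaleR_conv_of_real)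
    show "p (x + y) \<le> p x + p y" if "x \<in> Collect bounded_fun" "y \<in> Collect bounded_fun" for x y
      using le_p that by (intro p_le) (force intro: norm_triangle_le add_mono)
    show "cmod (L x) \<le> p x" if "x \<in> W" for x
      using that le_p W(1) by (intro L(3)) auto
  qed (use psc L W in \<open>auto simp: sc_def plus_fun_def\<close>)
  have "contractive_functional F"
  proof
    show "cmod (F g) \<le> C" if "\<And>\<omega>. cmod (g \<omega>) \<le> C" for g C
      using F(3)[of g] p_le[of g C] bounded_funI[of g C] that by force
  qed (use F(1,2) in \<open>auto simp: sc_def plus_fun_def\<close>)
  then show ?thesis using F(4) that by blast
qed

subsection \<open>The dual extremal problem\<close>

text \<open>
  In the application \<open>A\<close> consists of the bounded sequences of holomorphic functions on the unit
  ball that converge at two given points, \<open>\<chi>0\<close> and \<open>\<chi>1\<close> are the limits at these points, and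
  \<open>f\<close> is an extremal sequence for the Caratheodory distance.
\<close>

locale extremal_pair =
  fixes A :: "('i \<Rightarrow> complex) set" and f :: "'i \<Rightarrow> complex"
    and \<chi>0 \<chi>1 :: "('i \<Rightarrow> complex) \<Rightarrow> complex" and s :: real
  assumes A_bounded: "g \<in> A \<Longrightarrow> bounded_fun g"
    and A_const: "(\<lambda>_. c) \<in> A"
    and A_add: "g \<in> A \<Longrightarrow> h \<in> A \<Longrightarrow> (\<lambda>\<omega>. g \<omega> + h \<omega>) \<in> A"
    and A_mult: "g \<in> A \<Longrightarrow> h \<in> A \<Longrightarrow> (\<lambda>\<omega>. g \<omega> * h \<omega>) \<in> A"
    and f_mem: "f \<in> A"
    and f_le: "cmod (f \<omega>) \<le> 1"
    and A_resolvent: "cmod u < 1 \<Longrightarrow> (\<lambda>\<omega>. 1 / (1 - u * f \<omega>)) \<in> A"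
    and \<chi>_const: "\<chi>0 (\<lambda>_. c) = c" "\<chi>1 (\<lambda>_. c) = c"
    and \<chi>_add: "g \<in> A \<Longrightarrow> h \<in> A \<Longrightarrow> \<chi>0 (\<lambda>\<omega>. g \<omega> + h \<omega>) = \<chi>0 g + \<chi>0 h"
      "g \<in> A \<Longrightarrow> h \<in> A \<Longrightarrow> \<chi>1 (\<lambda>\<omega>. g \<omega> + h \<omega>) = \<chi>1 g + \<chi>1 h"
    and \<chi>_mult: "g \<in> A \<Longrightarrow> h \<in> A \<Longrightarrow> \<chi>0 (\<lambda>\<omega>. g \<omega> * h \<omega>) = \<chi>0 g * \<chi>0 h"
      "g \<in> A \<Longrightarrow> h \<in> A \<Longrightarrow> \<chi>1 (\<lambda>\<omega>. g \<omega> * h \<omega>) = \<chi>1 g * \<chi>1 h"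
    and \<chi>_f: "\<chi>0 f = 0" "\<chi>1 f = of_real s"
    and s: "0 < s" "s < 1"
    and extremal: "g \<in> A \<Longrightarrow> \<chi>0 g = 0 \<Longrightarrow> (\<And>\<omega>. cmod (g \<omega>) \<le> C) \<Longrightarrow> cmod (\<chi>1 g) \<le> s * C"
begin

lemma f_bounded: "bounded_fun f"
  by (rule A_bounded[OF f_mem])

lemma A_cmult: "g \<in> A \<Longrightarrow> (\<lambda>\<omega>. c * g \<omega>) \<in> A"
  by (rule A_mult[OF A_const])

lemma \<chi>_cmult:
  assumes "g \<in> A"
  shows "\<chi>0 (\<lambda>\<omega>. c * g \<omega>) = c * \<chi>0 g" "\<chi>1 (\<lambda>\<omega>. c * g \<omega>) = c * \<chi>1 g"
  using \<chi>_mult[OF A_const assms] by (simp_all add: \<chi>_const)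

end

text \<open>The second formula describes a functional of \<open>g\<close> that equals
  \<open>\<chi>1 g / s\<close> on the kernel of \<open>\<chi>0\<close> and \<open>s\<close> at the
  constant 1; decompose \<open>g\<close> as \<open>(g - \<chi>0 g) + \<chi>0 g\<close>. For
  \<open>g = f\<close> it reads \<open>M (f cnj f) = 1\<close>, so \<open>f\<close> is unimodular as
  far as \<open>M\<close> can see.\<close>

locale extremal_state = extremal_pair A f \<chi>0 \<chi>1 s + state M
  for A :: "('i \<Rightarrow> complex) set" and f \<chi>0 \<chi>1 s M +
  assumes M_eq: "g \<in> A \<Longrightarrow> M g = \<chi>1 g"
    and M_cnj: "g \<in> A \<Longrightarrow> M (\<lambda>\<omega>. g \<omega> * cnj (f \<omega>)) = (\<chi>1 g - (1 - s\<^sup>2) * \<chi>0 g) / s"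
context extremal_pair
begin

text \<open>
  If \<open>N\<close> extends \<open>\<chi>1 / s\<close> from the kernel of \<open>\<chi>0\<close>, then \<open>N f = 1\<close> forces \<open>N\<close> to live where
  \<open>f\<close> is unimodular, so that \<open>N\<close> is the state \<open>M\<close> multiplied by \<open>cnj f\<close>.
\<close>

lemma ex_extremal_state: "\<exists>M :: ('i \<Rightarrow> complex) \<Rightarrow> complex. extremal_state A f \<chi>0 \<chi>1 s M"
proof -
  define W where "W = {g \<in> A. \<chi>0 g = 0}"
  obtain N where N: "contractive_functional N" and NW: "\<And>g. g \<in> W \<Longrightarrow> N g = \<chi>1 g / s"
  proof (rule hahn_banach_bounded_fun[of W "\<lambda>g. \<chi>1 g / s"])
    show "cmod (\<chi>1 g / s) \<le> C" if "g \<in> W" "\<And>\<omega>. cmod (g \<omega>) \<le> C" for g C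
      using extremal[of g C] that s by (simp add: W_def norm_divide divide_simps mult.commute)
  qed (auto simp: W_def A_bounded A_const \<chi>_const A_add \<chi>_add A_cmult \<chi>_cmult add_divide_distrib)
  interpret N: contractive_functional N by (rule N)
  have Nf: "N f = 1"
    using NW[of f] s by (simp add: W_def f_mem \<chi>_f)
  have N_unimodular: "N (\<lambda>\<omega>. h \<omega> * (1 - f \<omega> * cnj (f \<omega>))) = 0" if h: "bounded_fun h" for h
  proof (rule ccontr)
    define v where "v = N (\<lambda>\<omega>. h \<omega> * (1 - f \<omega> * cnj (f \<omega>)))"
    assume "N (\<lambda>\<omega>. h \<omega> * (1 - f \<omega> * cnj (f \<omega>))) \<noteq> 0"
    then have v: "cmod v > 0" by (simp add: v_def)
    obtain c where c: "cmod c = 1" "c * v = of_real (cmod v)"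
      by (rule unimodular_rotation)
    obtain C where C: "C > 0" "\<And>\<omega>. cmod (h \<omega>) \<le> C"
      by (rule bounded_funE[OF h]) blast
    have b: "bounded_fun (\<lambda>\<omega>. h \<omega> * (1 - f \<omega> * cnj (f \<omega>)))"
      by (intro bounded_fun_intros h f_bounded)
    \<comment> \<open>The perturbation has modulus at most \<open>1 - |f|\<close>, because
      \<open>1 - |f|^2 \<le> 2 (1 - |f|)\<close>; this explains the factor 2. The sum stays bounded
      by 1, whereas \<open>N\<close> sends it to \<open>1 + |v| / (2 C)\<close>.\<close>
    have "cmod (f \<omega> + c / (2 * C) * (h \<omega> * (1 - f \<omega> * cnj (f \<omega>)))) \<le> 1" for \<omega>
    proof -
      have f1: "cmod (f \<omega>) \<le> 1" by (rule f_le)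
      have "1 - f \<omega> * cnj (f \<omega>) = of_real ((1 - cmod (f \<omega>)) * (1 + cmod (f \<omega>)))"
        using complex_norm_square[of "f \<omega>"] by (simp add: power2_eq_square algebra_simps)
      then have "cmod (1 - f \<omega> * cnj (f \<omega>)) = (1 - cmod (f \<omega>)) * (1 + cmod (f \<omega>))"
        using f1 by (simp only: norm_of_real abs_mult) simp
      then have "cmod (c / (2 * C) * (h \<omega> * (1 - f \<omega> * cnj (f \<omega>))))
          = (1 - cmod (f \<omega>)) * ((1 + cmod (f \<omega>)) / 2 * (cmod (h \<omega>) / C))"
        using c C by (simp add: norm_mult norm_divide)
      also have "\<dots> \<le> (1 - cmod (f \<omega>)) * (1 * 1)"
        using f1 C by (intro mult_left_mono mult_mono) auto
      finally show ?thesis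
        using norm_triangle_ineq[of "f \<omega>" "c / (2 * C) * (h \<omega> * (1 - f \<omega> * cnj (f \<omega>)))"] by simp
    qed
    then have "cmod (N (\<lambda>\<omega>. f \<omega> + c / (2 * C) * (h \<omega> * (1 - f \<omega> * cnj (f \<omega>))))) \<le> 1"
      by (rule N.norm_le)
    moreover have "N (\<lambda>\<omega>. f \<omega> + c / (2 * C) * (h \<omega> * (1 - f \<omega> * cnj (f \<omega>))))
        = of_real (1 + cmod v / (2 * C))"
      unfolding N.add[OF f_bounded bounded_fun_mult[OF bounded_fun_const b]] N.cmult[OF b] Nf
        v_def[symmetric] using c by simp
    ultimately have "\<bar>1 + cmod v / (2 * C)\<bar> \<le> 1" by (simp only: norm_of_real)
    with v C show False by (simp add: abs_le_iff divide_le_0_iff)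
  qed
  have Nf2: "N (\<lambda>\<omega>. h \<omega> * f \<omega> * cnj (f \<omega>)) = N h" if h: "bounded_fun h" for h
  proof -
    have "N (\<lambda>\<omega>. h \<omega> - h \<omega> * f \<omega> * cnj (f \<omega>)) = 0"
      using N_unimodular[OF h] by (simp add: algebra_simps)
    then show ?thesis by (simp add: N.diff bounded_fun_intros h f_bounded)
  qed
  \<comment> \<open>\<open>N f = 1\<close> becomes \<open>M 1 = 1\<close>, and by \<open>Nf2\<close>
    multiplication by \<open>cnj f\<close> leads back from \<open>M\<close> to
    \<open>N\<close>.\<close>
  define M where "M = (\<lambda>h. N (\<lambda>\<omega>. h \<omega> * f \<omega>))"
  have "state M"
  proof
    fix g h :: "'i \<Rightarrow> complex" and c assume g: "bounded_fun g"
    show "M (\<lambda>\<omega>. c * g \<omega>) = c * M g"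
      using N.cmult[OF bounded_fun_mult[OF g f_bounded], of c] by (simp add: M_def mult.assoc)
    assume h: "bounded_fun h"
    show "M (\<lambda>\<omega>. g \<omega> + h \<omega>) = M g + M h"
      using N.add[OF bounded_fun_mult[OF g f_bounded] bounded_fun_mult[OF h f_bounded]]
      by (simp add: M_def distrib_right)
  next
    fix g :: "'i \<Rightarrow> complex" and C assume g: "\<And>\<omega>. cmod (g \<omega>) \<le> C"
    then have "C \<ge> 0" by (meson norm_ge_zero order_trans)
    have "cmod (g \<omega>) * cmod (f \<omega>) \<le> C * 1" for \<omega>
      using g f_le \<open>C \<ge> 0\<close> by (intro mult_mono) auto
    then show "cmod (M g) \<le> C"
      unfolding M_def by (intro N.norm_le) (simp add: norm_mult)
  qed (simp add: M_def Nf)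
  interpret M: state M by fact
  \<comment> \<open>The product \<open>g f\<close> lies in the kernel of \<open>\<chi>0\<close> for
    every \<open>g\<close> in \<open>A\<close>, so
    \<open>N (g f) = \<chi>1 g * s / s\<close>.\<close>
  have M\<chi>: "M g = \<chi>1 g" if "g \<in> A" for g
    using NW[of "\<lambda>\<omega>. g \<omega> * f \<omega>"] that s by (simp add: M_def W_def A_mult \<chi>_mult f_mem \<chi>_f)
  have Mcnj: "M (\<lambda>\<omega>. h \<omega> * cnj (f \<omega>)) = N h" if h: "bounded_fun h" for h
    using Nf2[OF h] by (simp add: M_def algebra_simps)
  \<comment> \<open>The constant 1 lies outside the kernel of \<open>\<chi>0\<close>, so the
    extension does not prescribe \<open>N 1\<close>; conjugation does:
    \<open>N 1 = M (cnj f) = cnj (M f) = s\<close>.\<close>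
  have N1: "N (\<lambda>_. 1) = s"
    using Mcnj[OF bounded_fun_const[of 1]] M.cnj_eq[OF f_bounded] by (simp add: M\<chi> f_mem \<chi>_f)
  have "M (\<lambda>\<omega>. g \<omega> * cnj (f \<omega>)) = (\<chi>1 g - (1 - s\<^sup>2) * \<chi>0 g) / s" if g: "g \<in> A" for g
  proof -
    have gA: "(\<lambda>\<omega>. g \<omega> + - \<chi>0 g) \<in> A" by (intro A_add A_const g)
    have "N (\<lambda>\<omega>. g \<omega> + - \<chi>0 g) = (\<chi>1 g - \<chi>0 g) / s"
      using NW[of "\<lambda>\<omega>. g \<omega> + - \<chi>0 g"] \<chi>_add[OF g A_const[of "- \<chi>0 g"]] gA
      by (simp add: W_def \<chi>_const)
    moreover have "N (\<lambda>\<omega>. g \<omega> + - \<chi>0 g) = N g - \<chi>0 g * s"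
      using N.add[OF A_bounded[OF g] bounded_fun_const, of "- \<chi>0 g"]
        N.cmult[OF bounded_fun_const[of 1], of "- \<chi>0 g"] by (simp add: N1)
    ultimately have "N g = (\<chi>1 g - \<chi>0 g) / s + \<chi>0 g * s" by (simp add: algebra_simps)
    then show ?thesis
      using Mcnj[OF A_bounded[OF g]] s by (simp add: field_simps power2_eq_square)
  qed
  with M\<chi> have "extremal_state A f \<chi>0 \<chi>1 s M"
    by unfold_locales
  then show ?thesis by (intro exI[of _ M])
qed

end

section \<open>The Poisson-weighted disc through the two evaluations\<close>

context extremal_state
begin

text \<open>This is \<open>|1 - s f|^2\<close>. Where \<open>|f| = 1\<close>, it is
  \<open>1 - s^2\<close> divided by the Poisson kernel of \<open>s\<close> at \<open>f\<close>. The
  factored complex form lets one factor cancel against a resolvent.\<close>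

definition weight :: "'i \<Rightarrow> complex"
  where "weight \<omega> = (1 - s * f \<omega>) * cnj (1 - s * f \<omega>)"

text \<open>
  Where \<open>\<bar>f\<bar> = 1\<close>, \<open>kernel u\<close> below is the quotient of the Poisson kernels of \<open>u\<close> and \<open>s\<close> at \<open>f\<close>,
  and \<open>disc u\<close> is \<open>M\<close> weighted by it, in a form that is visibly holomorphic in \<open>u\<close>: the part of the
  kernel that is antiholomorphic in \<open>u\<close> is annihilated by \<open>M\<close>.
\<close>

definition disc :: "complex \<Rightarrow> ('i \<Rightarrow> complex) \<Rightarrow> complex"
  where "disc u g = M (\<lambda>\<omega>. g \<omega> * weight \<omega> / (1 - u * cnj (f \<omega>))) / (1 - s\<^sup>2)"

definition disc_deriv :: "complex \<Rightarrow> ('i \<Rightarrow> complex) \<Rightarrow> complex"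
  where "disc_deriv u g = M (\<lambda>\<omega>. g \<omega> * weight \<omega> * cnj (f \<omega>) / (1 - u * cnj (f \<omega>))\<^sup>2) / (1 - s\<^sup>2)"

lemma one_minus_s2: "1 - (complex_of_real s)\<^sup>2 \<noteq> 0" "cmod (1 - (complex_of_real s)\<^sup>2) = 1 - s\<^sup>2"
proof -
  have s2: "s\<^sup>2 < 1" using s by (simp add: power_less_one_iff)
  have *: "1 - (complex_of_real s)\<^sup>2 = of_real (1 - s\<^sup>2)" by simp
  show "cmod (1 - (complex_of_real s)\<^sup>2) = 1 - s\<^sup>2"
    unfolding * norm_of_real using s2 by simp
  then show "1 - (complex_of_real s)\<^sup>2 \<noteq> 0" using s2 by auto
qed

lemma weight_bounded [bounded_fun_intros]: "bounded_fun weight"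
  unfolding weight_def by (intro bounded_fun_intros f_bounded)

lemma weight_le: "cmod (weight \<omega>) \<le> 4"
proof -
  have "cmod (1 - s * f \<omega>) \<le> 2"
    using norm_triangle_ineq4[of 1 "s * f \<omega>"] f_le[of \<omega>] s mult_le_one[of s "cmod (f \<omega>)"]
    by (simp add: norm_mult)
  then have "cmod (1 - s * f \<omega>) * cmod (1 - s * f \<omega>) \<le> 2 * 2" by (intro mult_mono) auto
  then show ?thesis by (simp only: weight_def norm_mult complex_mod_cnj)
qed

lemma resolvent_ge: "1 - cmod u \<le> cmod (1 - u * cnj (f \<omega>))"
proof -
  have "cmod u * cmod (f \<omega>) \<le> cmod u" using f_le by (simp add: mult_left_le)
  then show ?thesis
    using norm_triangle_ineq2[of 1 "u * cnj (f \<omega>)"] by (simp add: norm_mult)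
qed

lemma resolvent_nonzero:
  assumes "cmod u < 1"
  shows "1 - u * cnj (f \<omega>) \<noteq> 0" "1 - cnj u * f \<omega> \<noteq> 0"
proof -
  show *: "1 - u * cnj (f \<omega>) \<noteq> 0"
    using resolvent_ge[of u \<omega>] assms by auto
  have "cnj (1 - u * cnj (f \<omega>)) \<noteq> 0" unfolding complex_cnj_zero_iff by (rule *)
  then show "1 - cnj u * f \<omega> \<noteq> 0" by simp
qed

lemma resolvent_bounded:
  assumes "cmod u < 1"
  shows "bounded_fun (\<lambda>\<omega>. 1 / (1 - u * cnj (f \<omega>)))"
  using bounded_fun_cnj[OF A_bounded[OF A_resolvent[of "cnj u"]]] assms by simp

text \<open>Reweighting moves the evaluation from \<open>\<chi>1\<close> to \<open>\<chi>0\<close>: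
  when \<open>weight\<close> is expanded, the four contributions of \<open>\<chi>1 g\<close> cancel
  and only the \<open>\<chi>0\<close> term of \<open>M_cnj\<close> survives.\<close>

lemma M_weight:
  assumes g: "g \<in> A"
  shows "M (\<lambda>\<omega>. g \<omega> * weight \<omega>) = (1 - s\<^sup>2) * \<chi>0 g"
proof -
  have gf: "(\<lambda>\<omega>. g \<omega> * f \<omega>) \<in> A" by (rule A_mult[OF g f_mem])
  have "M (\<lambda>\<omega>. g \<omega> * weight \<omega>) = M (\<lambda>\<omega>. (g \<omega> + - s * (g \<omega> * f \<omega>))
      + (- s * (g \<omega> * cnj (f \<omega>)) + s\<^sup>2 * ((g \<omega> * f \<omega>) * cnj (f \<omega>))))"
    by (simp add: weight_def algebra_simps power2_eq_square)
  also have "\<dots> = (M g + - s * M (\<lambda>\<omega>. g \<omega> * f \<omega>)) + (- s * M (\<lambda>\<omega>. g \<omega> * cnj (f \<omega>))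
      + s\<^sup>2 * M (\<lambda>\<omega>. (g \<omega> * f \<omega>) * cnj (f \<omega>)))"
    by (simp only: add cmult bounded_fun_intros f_bounded A_bounded[OF g])
  also have "\<dots> = (1 - s\<^sup>2) * \<chi>0 g"
    unfolding M_eq[OF g] M_eq[OF gf] M_cnj[OF g] M_cnj[OF gf] \<chi>_mult[OF g f_mem] \<chi>_f
    using s by (simp add: field_simps power2_eq_square)
  finally show ?thesis .
qed

text \<open>A multiple of \<open>f\<close> vanishes under \<open>\<chi>0\<close>. This is what
  removes the part of the Poisson kernel that is antiholomorphic in \<open>u\<close>.\<close>

lemma M_f_weight: "g \<in> A \<Longrightarrow> M (\<lambda>\<omega>. g \<omega> * f \<omega> * weight \<omega>) = 0"
  using M_weight[OF A_mult[OF _ f_mem]] by (simp add: \<chi>_mult f_mem \<chi>_f)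

text \<open>No continuity of \<open>\<chi>0\<close> is assumed, so the geometric series is replaced
  by the identity \<open>r = 1 + cnj u r f\<close> for the resolvent \<open>r\<close>, together with
  \<open>\<chi>0 f = 0\<close>.\<close>

lemma \<chi>0_resolvent:
  assumes "cmod u < 1"
  shows "\<chi>0 (\<lambda>\<omega>. 1 / (1 - cnj u * f \<omega>)) = 1"
proof -
  let ?r = "\<lambda>\<omega>. 1 / (1 - cnj u * f \<omega>)"
  have r: "?r \<in> A" using A_resolvent[of "cnj u"] assms by simp
  have eq: "?r = (\<lambda>\<omega>. 1 + cnj u * (?r \<omega> * f \<omega>))"
    using resolvent_nonzero(2)[OF assms] by (auto simp: fun_eq_iff divide_simps)
  have "\<chi>0 ?r = \<chi>0 (\<lambda>\<omega>. 1 + cnj u * (?r \<omega> * f \<omega>))" using eq by (rule arg_cong)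
  also have "\<dots> = 1"
    unfolding \<chi>_add(1)[OF A_const A_cmult[OF A_mult[OF r f_mem]]] \<chi>_const
      \<chi>_cmult[OF A_mult[OF r f_mem]] \<chi>_mult(1)[OF r f_mem] \<chi>_f by simp
  finally show ?thesis .
qed

text \<open>The resolvent in \<open>disc\<close> involves \<open>cnj f\<close> and so is not known
  to lie in \<open>A\<close>. Since \<open>weight\<close> is real, conjugation turns it into the
  resolvent of \<open>f\<close>, to which \<open>M_weight\<close> applies.\<close>

lemma disc_one:
  assumes u: "cmod u < 1"
  shows "disc u (\<lambda>_. 1) = 1"
proof -
  have b: "bounded_fun (\<lambda>\<omega>. 1 / (1 - u * cnj (f \<omega>)) * weight \<omega>)"
    by (intro bounded_fun_intros resolvent_bounded u)
  have "cnj (M (\<lambda>\<omega>. 1 / (1 - u * cnj (f \<omega>)) * weight \<omega>)) = M (\<lambda>\<omega>. 1 / (1 - cnj u * f \<omega>) * weight \<omega>)"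
    by (subst cnj_eq[OF b, symmetric]) (simp add: weight_def mult.commute)
  also have "\<dots> = 1 - s\<^sup>2"
    using M_weight[of "\<lambda>\<omega>. 1 / (1 - cnj u * f \<omega>)"] A_resolvent[of "cnj u"] u
    by (simp add: \<chi>0_resolvent)
  finally have "M (\<lambda>\<omega>. 1 / (1 - u * cnj (f \<omega>)) * weight \<omega>) = 1 - s\<^sup>2"
    by (subst complex_cnj_cancel_iff[symmetric]) simp
  then show ?thesis
    using one_minus_s2 by (simp add: disc_def mult.commute)
qed

text \<open>
  With \<open>1 - \<bar>u\<bar>\<^sup>2 \<bar>f\<bar>\<^sup>2\<close> instead of \<open>1 - \<bar>u\<bar>\<^sup>2\<close> the decomposition \<open>kernel_eq\<close> holds even where
  \<open>\<bar>f\<bar> < 1\<close>.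
\<close>

definition kernel :: "complex \<Rightarrow> 'i \<Rightarrow> real"
  where "kernel u \<omega> = (1 - (cmod u)\<^sup>2 * (cmod (f \<omega>))\<^sup>2) * (cmod (1 - s * f \<omega>))\<^sup>2 /
    ((1 - s\<^sup>2) * (cmod (1 - u * cnj (f \<omega>)))\<^sup>2)"

lemma kernel_eq:
  assumes u: "cmod u < 1"
  shows "of_real (kernel u \<omega>) = (weight \<omega> / (1 - u * cnj (f \<omega>))
    + cnj u / (1 - cnj u * f \<omega>) * f \<omega> * weight \<omega>) / (1 - s\<^sup>2)"
proof -
  have nz: "1 - u * cnj (f \<omega>) \<noteq> 0" "1 - cnj u * f \<omega> \<noteq> 0"
    by (rule resolvent_nonzero[OF u])+
  have "of_real (kernel u \<omega>) = (1 - u * cnj u * (f \<omega> * cnj (f \<omega>))) * weight \<omega>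
      / ((1 - s\<^sup>2) * ((1 - u * cnj (f \<omega>)) * (1 - cnj u * f \<omega>)))"
    unfolding kernel_def of_real_divide of_real_mult of_real_diff complex_norm_square weight_def
    by simp
  also have "\<dots> = (1 - u * cnj u * (f \<omega> * cnj (f \<omega>))) / ((1 - u * cnj (f \<omega>)) * (1 - cnj u * f \<omega>))
      * weight \<omega> / (1 - s\<^sup>2)"
    by simp
  also have "(1 - u * cnj u * (f \<omega> * cnj (f \<omega>))) / ((1 - u * cnj (f \<omega>)) * (1 - cnj u * f \<omega>))
      = 1 / (1 - u * cnj (f \<omega>)) + cnj u / (1 - cnj u * f \<omega>) * f \<omega>"
    using nz by (simp add: add_frac_eq algebra_simps)
  finally show ?thesis by (simp add: algebra_simps)
qed

lemma kernel_bounded: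
  assumes u: "cmod u < 1"
  shows "bounded_fun (\<lambda>\<omega>. of_real (kernel u \<omega>))"
proof -
  have "bounded_fun (\<lambda>\<omega>. (1 / (1 - u * cnj (f \<omega>)) * weight \<omega>
      + cnj u * (1 / (1 - cnj u * f \<omega>)) * f \<omega> * weight \<omega>) * (1 / (1 - s\<^sup>2)))"
    using A_bounded[OF A_resolvent[of "cnj u"]] u
    by (intro bounded_fun_intros resolvent_bounded f_bounded) auto
  then show ?thesis by (simp add: kernel_eq[OF u])
qed

text \<open>The two summands of \<open>kernel_eq\<close> play opposite roles: the first gives
  \<open>disc\<close>, the second is annihilated by \<open>M_f_weight\<close>. On \<open>A\<close>
  the holomorphic expression is therefore an average against a nonnegative kernel, which gives norm
  bounds.\<close>

lemma disc_eq_kernel: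
  assumes u: "cmod u < 1" and g: "g \<in> A"
  shows "disc u g = M (\<lambda>\<omega>. g \<omega> * of_real (kernel u \<omega>))"
proof -
  let ?h = "\<lambda>\<omega>. g \<omega> * (cnj u * (1 / (1 - cnj u * f \<omega>)))"
  have h: "?h \<in> A"
    using A_resolvent[of "cnj u"] u by (intro A_mult g A_const) auto
  have "g \<omega> * of_real (kernel u \<omega>) =
      (g \<omega> * weight \<omega> * (1 / (1 - u * cnj (f \<omega>))) + ?h \<omega> * f \<omega> * weight \<omega>) / (1 - s\<^sup>2)" for \<omega>
    unfolding kernel_eq[OF u] by (simp add: algebra_simps)
  then have "M (\<lambda>\<omega>. g \<omega> * of_real (kernel u \<omega>)) =
      M (\<lambda>\<omega>. (g \<omega> * weight \<omega> * (1 / (1 - u * cnj (f \<omega>))) + ?h \<omega> * f \<omega> * weight \<omega>) / (1 - s\<^sup>2))"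
    by (rule arg_cong[OF ext])
  also have "\<dots> = (M (\<lambda>\<omega>. g \<omega> * weight \<omega> * (1 / (1 - u * cnj (f \<omega>)))) + M (\<lambda>\<omega>. ?h \<omega> * f \<omega> * weight \<omega>)) / (1 - s\<^sup>2)"
    using A_bounded[OF h] A_bounded[OF g] resolvent_bounded[OF u]
    by (simp only: divide add bounded_fun_intros f_bounded)
  also have "\<dots> = disc u g"
    unfolding M_f_weight[OF h] by (simp add: disc_def)
  finally show ?thesis by simp
qed

lemma disc_0: "g \<in> A \<Longrightarrow> disc 0 g = \<chi>0 g"
  using one_minus_s2 by (simp add: disc_def M_weight)

text \<open>At \<open>u = s\<close> the denominator cancels one factor of \<open>weight\<close>.
  What remains, \<open>1 - s f\<close>, lies in \<open>A\<close>, and \<open>\<chi>1\<close> sends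
  it to \<open>1 - s^2\<close>.\<close>

lemma disc_s:
  assumes g: "g \<in> A"
  shows "disc s g = \<chi>1 g"
proof -
  have "weight \<omega> / (1 - s * cnj (f \<omega>)) = 1 - s * f \<omega>" for \<omega>
    using resolvent_nonzero(1)[of s] s by (simp add: weight_def)
  then have "g \<omega> * weight \<omega> / (1 - s * cnj (f \<omega>)) = g \<omega> + - s * (g \<omega> * f \<omega>)" for \<omega>
    by (simp only: times_divide_eq_right[symmetric]) (simp add: algebra_simps)
  then have "M (\<lambda>\<omega>. g \<omega> * weight \<omega> / (1 - s * cnj (f \<omega>))) = M (\<lambda>\<omega>. g \<omega> + - s * (g \<omega> * f \<omega>))"
    by (rule arg_cong[OF ext])
  also have "\<dots> = (1 - s\<^sup>2) * \<chi>1 g"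
    unfolding M_eq[OF A_add[OF g A_cmult[OF A_mult[OF g f_mem]]]]
      \<chi>_add(2)[OF g A_cmult[OF A_mult[OF g f_mem]]] \<chi>_cmult(2)[OF A_mult[OF g f_mem]]
      \<chi>_mult(2)[OF g f_mem] \<chi>_f by (simp add: algebra_simps power2_eq_square)
  finally show ?thesis
    using one_minus_s2 by (simp add: disc_def)
qed

text \<open>A Harnack inequality: \<open>1 - |u f|^2 \<ge> 1 - |u|^2\<close> in the numerator and
  \<open>|1 - u cnj f|^2 \<le> 4\<close> in the denominator.\<close>

lemma kernel_ge:
  assumes u: "cmod u < 1"
  shows "(1 - (cmod u)\<^sup>2) / 4 * kernel 0 \<omega> \<le> kernel u \<omega>"
proof -
  define a where "a = cmod (1 - u * cnj (f \<omega>))"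
  define k where "k = (cmod (1 - s * f \<omega>))\<^sup>2 / (1 - s\<^sup>2)"
  have k: "k \<ge> 0" using s by (simp add: k_def power_le_one)
  have a0: "a > 0" using resolvent_nonzero[OF u] by (simp add: a_def)
  have le: "cmod u * cmod (f \<omega>) \<le> cmod u" using f_le by (simp add: mult_left_le)
  have "a \<le> 2"
    using norm_triangle_ineq4[of 1 "u * cnj (f \<omega>)"] le u by (simp add: a_def norm_mult)
  then have a4: "a\<^sup>2 \<le> 4" using a0 power_mono[of a 2 2] by simp
  have "(cmod u)\<^sup>2 * (cmod (f \<omega>))\<^sup>2 \<le> (cmod u)\<^sup>2"
    using le by (metis norm_ge_zero power_mono power_mult_distrib mult_nonneg_nonneg)
  moreover have "(cmod u)\<^sup>2 < 1" using u by (simp add: power_less_one_iff)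
  ultimately have "(1 - (cmod u)\<^sup>2) / 4 \<le> (1 - (cmod u)\<^sup>2 * (cmod (f \<omega>))\<^sup>2) / a\<^sup>2"
    using a4 a0 by (intro frac_le) auto
  then have "(1 - (cmod u)\<^sup>2) / 4 * k \<le> (1 - (cmod u)\<^sup>2 * (cmod (f \<omega>))\<^sup>2) / a\<^sup>2 * k"
    using k by (rule mult_right_mono)
  then show ?thesis by (simp add: kernel_def a_def k_def mult.commute)
qed

text \<open>The kernel is \<open>c\<close> times \<open>kernel 0\<close>, which reproduces
  \<open>\<chi>0\<close>, plus a nonnegative rest of mass \<open>1 - c\<close>. The share of
  \<open>\<chi>0\<close> keeps the disc in the open ball, where the plain bound \<open>C\<close>
  would only give the closed one.\<close>

lemma disc_norm_le:
  assumes u: "cmod u < 1" and g: "g \<in> A" and C: "\<And>\<omega>. cmod (g \<omega>) \<le> C"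
  defines "c \<equiv> (1 - (cmod u)\<^sup>2) / 4"
  shows "cmod (disc u g) \<le> (1 - c) * C + c * cmod (\<chi>0 g)"
proof -
  have c: "c \<ge> 0" using u by (simp add: c_def power_le_one)
  have b: "bounded_fun (\<lambda>\<omega>. of_real (kernel v \<omega>))" if "cmod v < 1" for v
    by (rule kernel_bounded[OF that])
  have M1: "M (\<lambda>\<omega>. of_real (kernel v \<omega>)) = 1" if "cmod v < 1" for v
    using disc_eq_kernel[OF that A_const[of 1]] disc_one[OF that] by simp
  define k where "k = (\<lambda>\<omega>. kernel u \<omega> - c * kernel 0 \<omega>)"
  have k: "(\<lambda>\<omega>. of_real (k \<omega>)) = (\<lambda>\<omega>. of_real (kernel u \<omega>) - of_real c * complex_of_real (kernel 0 \<omega>))"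
    by (simp add: k_def)
  have k0: "k \<omega> \<ge> 0" for \<omega>
    using kernel_ge[OF u] by (simp add: k_def c_def)
  have kb: "bounded_fun (\<lambda>\<omega>. of_real (k \<omega>))"
    unfolding k by (intro bounded_fun_intros b u) simp
  have gb: "bounded_fun g" by (rule A_bounded[OF g])
  have "M (\<lambda>\<omega>. of_real (k \<omega>)) = 1 - c"
    unfolding k using u by (simp add: diff cmult b bounded_fun_intros M1)
  then have "cmod (M (\<lambda>\<omega>. g \<omega> * of_real (k \<omega>))) \<le> C * (1 - c)"
    using weighted_norm_le[OF kb k0 C] by simp
  moreover have "disc u g = M (\<lambda>\<omega>. g \<omega> * of_real (k \<omega>) + of_real c * (g \<omega> * of_real (kernel 0 \<omega>)))"
    unfolding disc_eq_kernel[OF u g] by (simp add: k_def algebra_simps)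
  then have "disc u g = M (\<lambda>\<omega>. g \<omega> * of_real (k \<omega>)) + c * \<chi>0 g"
    using disc_eq_kernel[OF _ g, of 0] disc_0[OF g]
    by (simp add: add cmult bounded_fun_intros gb b kb)
  ultimately show ?thesis
    using norm_triangle_ineq[of "M (\<lambda>\<omega>. g \<omega> * of_real (k \<omega>))" "c * \<chi>0 g"] c
    by (simp add: norm_mult mult.commute)
qed

lemma disc_bounded:
  assumes u: "cmod u < 1" and g: "bounded_fun g"
  shows "bounded_fun (\<lambda>\<omega>. g \<omega> * weight \<omega> / (1 - u * cnj (f \<omega>)))"
    "bounded_fun (\<lambda>\<omega>. g \<omega> * weight \<omega> * cnj (f \<omega>) / (1 - u * cnj (f \<omega>))\<^sup>2)"
  using bounded_fun_mult[OF bounded_fun_mult[OF g weight_bounded] resolvent_bounded[OF u]]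
    bounded_fun_mult[OF bounded_fun_mult[OF bounded_fun_mult[OF g weight_bounded] bounded_fun_cnj[OF f_bounded]]
      bounded_fun_power[OF resolvent_bounded[OF u], of 2]]
  by (simp_all add: power_one_over)

lemma disc_linear:
  assumes "cmod u < 1" "bounded_fun g"
  shows "disc u (\<lambda>\<omega>. c * g \<omega>) = c * disc u g"
    and "bounded_fun h \<Longrightarrow> disc u (\<lambda>\<omega>. g \<omega> + h \<omega>) = disc u g + disc u h"
    and "disc_deriv u (\<lambda>\<omega>. c * g \<omega>) = c * disc_deriv u g"
    and "bounded_fun h \<Longrightarrow> disc_deriv u (\<lambda>\<omega>. g \<omega> + h \<omega>) = disc_deriv u g + disc_deriv u h"
  using assms add[OF disc_bounded(1)[of u g] disc_bounded(1)[of u h]] cmult[OF disc_bounded(1)[of u g], of c]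
    add[OF disc_bounded(2)[of u g] disc_bounded(2)[of u h]] cmult[OF disc_bounded(2)[of u g], of c]
  by (simp_all add: disc_def disc_deriv_def distrib_right add_divide_distrib mult.assoc)

lemma disc_deriv_norm_le:
  assumes u: "cmod u < 1" and C: "\<And>\<omega>. cmod (g \<omega>) \<le> C"
  shows "cmod (disc_deriv u g) \<le> C * (4 / ((1 - s\<^sup>2) * (1 - cmod u)\<^sup>2))"
proof -
  have C0: "C \<ge> 0" using C by (meson norm_ge_zero order_trans)
  have s2: "0 < 1 - s\<^sup>2" using s by (simp add: power_less_one_iff)
  have "cmod (g \<omega> * weight \<omega> * cnj (f \<omega>) / (1 - u * cnj (f \<omega>))\<^sup>2) \<le> C * 4 * 1 / (1 - cmod u)\<^sup>2" for \<omega>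
    unfolding norm_mult norm_divide complex_mod_cnj norm_power
    using resolvent_ge[of u \<omega>] u C0
    by (intro frac_le mult_mono C weight_le f_le power_mono mult_nonneg_nonneg) auto
  then have "cmod (M (\<lambda>\<omega>. g \<omega> * weight \<omega> * cnj (f \<omega>) / (1 - u * cnj (f \<omega>))\<^sup>2)) \<le> C * 4 * 1 / (1 - cmod u)\<^sup>2"
    by (rule norm_le)
  from divide_right_mono[OF this less_imp_le[OF s2]]
  have "cmod (disc_deriv u g) \<le> C * 4 * 1 / (1 - cmod u)\<^sup>2 / (1 - s\<^sup>2)"
    by (simp add: disc_deriv_def norm_divide one_minus_s2(2))
  then show ?thesis by (simp add: mult.commute)
qed

text \<open>With \<open>a = cnj f\<close>, the Taylor remainder of \<open>x / (1 - u a)\<close> is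
  exactly \<open>x h^2 a^2 / ((1 - u a)^2 (1 - (u + h) a))\<close>. The restriction on
  \<open>h\<close> keeps \<open>1 - |u + h|\<close> above \<open>(1 - |u|) / 2\<close>; this factor
  2 and the bound 4 on \<open>weight\<close> make the 8. Only \<open>C\<close> depends on
  \<open>g\<close>, so the estimate passes to the norm of the bidual.\<close>

lemma disc_remainder_le:
  assumes u: "cmod u < 1" and h: "cmod h \<le> (1 - cmod u) / 2" and C: "\<And>\<omega>. cmod (g \<omega>) \<le> C"
  shows "cmod (disc (u + h) g - disc u g - h * disc_deriv u g)
    \<le> C * (8 / ((1 - s\<^sup>2) * (1 - cmod u) ^ 3)) * (cmod h)\<^sup>2"
proof -
  have C0: "C \<ge> 0" using C by (meson norm_ge_zero order_trans)
  have gb: "bounded_fun g" using C by (rule bounded_funI)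
  have s2: "0 < 1 - s\<^sup>2" using s by (simp add: power_less_one_iff)
  have uh: "cmod (u + h) \<le> (1 + cmod u) / 2"
    using norm_triangle_ineq[of u h] h by (simp add: field_simps)
  then have uh1: "cmod (u + h) < 1" using u by simp
  let ?r = "\<lambda>\<omega>. g \<omega> * weight \<omega> / (1 - (u + h) * cnj (f \<omega>)) - g \<omega> * weight \<omega> / (1 - u * cnj (f \<omega>))
      - h * (g \<omega> * weight \<omega> * cnj (f \<omega>) / (1 - u * cnj (f \<omega>))\<^sup>2)"
  have "cmod (?r \<omega>) \<le> C * 4 * (cmod h)\<^sup>2 * 1 / ((1 - cmod u)\<^sup>2 * ((1 - cmod u) / 2))" for \<omega>
  proof -
    have id: "x / (1 - (u + h) * a) - x / (1 - u * a) - h * (x * a / (1 - u * a)\<^sup>2)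
        = x * h\<^sup>2 * a\<^sup>2 / ((1 - u * a)\<^sup>2 * (1 - (u + h) * a))"
      if "1 - (u + h) * a \<noteq> 0" "1 - u * a \<noteq> 0" for x a :: complex
      using that by (simp add: divide_simps) (simp add: algebra_simps power2_eq_square)
    have r: "?r \<omega> = g \<omega> * weight \<omega> * h\<^sup>2 * (cnj (f \<omega>))\<^sup>2 / ((1 - u * cnj (f \<omega>))\<^sup>2 * (1 - (u + h) * cnj (f \<omega>)))"
      by (rule id) (rule resolvent_nonzero(1)[OF uh1] resolvent_nonzero(1)[OF u])+
    have "(1 - cmod u) / 2 \<le> cmod (1 - (u + h) * cnj (f \<omega>))"
      using resolvent_ge[of "u + h" \<omega>] uh by (simp add: field_simps)
    then show ?thesis
      using resolvent_ge[of u \<omega>] u C0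
      unfolding r norm_mult norm_divide complex_mod_cnj norm_power
      by (intro frac_le mult_mono C weight_le f_le power_mono mult_nonneg_nonneg power_le_one) auto
  qed
  then have "cmod (M ?r) \<le> C * 4 * (cmod h)\<^sup>2 * 1 / ((1 - cmod u)\<^sup>2 * ((1 - cmod u) / 2))"
    by (rule norm_le)
  from divide_right_mono[OF this less_imp_le[OF s2]]
  have "cmod (M ?r / (1 - s\<^sup>2)) \<le> C * 4 * (cmod h)\<^sup>2 * 1 / ((1 - cmod u)\<^sup>2 * ((1 - cmod u) / 2)) / (1 - s\<^sup>2)"
    by (simp only: norm_divide one_minus_s2(2) of_real_diff of_real_power of_real_1)
  moreover have "disc (u + h) g - disc u g - h * disc_deriv u g = M ?r / (1 - s\<^sup>2)"
    using diff[OF bounded_fun_diff[OF disc_bounded(1)[OF uh1 gb] disc_bounded(1)[OF u gb]]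
        bounded_fun_mult[OF bounded_fun_const disc_bounded(2)[OF u gb]], of h]
      diff[OF disc_bounded(1)[OF uh1 gb] disc_bounded(1)[OF u gb]] cmult[OF disc_bounded(2)[OF u gb], of h]
    by (simp add: disc_def disc_deriv_def diff_divide_distrib)
  ultimately have "cmod (disc (u + h) g - disc u g - h * disc_deriv u g)
      \<le> C * 4 * (cmod h)\<^sup>2 * 1 / ((1 - cmod u)\<^sup>2 * ((1 - cmod u) / 2)) / (1 - s\<^sup>2)"
    by (simp only:)
  then show ?thesis by (simp add: power2_eq_square power3_eq_cube field_simps)
qed

end

subsection \<open>The Schwarz--Pick lemma\<close>

lemma schwarz_pick:
  assumes hol: "g holomorphic_on ball 0 1" and im: "g ` ball 0 1 \<subseteq> ball 0 1"
    and u: "cmod u < 1" and v: "cmod v < 1"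
  shows "cmod ((g u - g v) / (1 - cnj (g v) * g u)) \<le> cmod ((u - v) / (1 - cnj v * u))"
proof -
  have g: "cmod (g x) < 1" if "cmod x < 1" for x
    using im that by (auto simp: image_subset_iff)
  define k where "k = Moebius_function 0 (g v) \<circ> g \<circ> Moebius_function 0 (- v)"
  have v': "cmod (- v) < 1" using v by simp
  have k0: "k 0 = 0"
    by (simp add: k_def Moebius_function_of_zero Moebius_function_eq_zero)
  have "(g \<circ> Moebius_function 0 (- v)) holomorphic_on ball 0 1"
    by (rule holomorphic_on_compose_gen[OF Moebius_function_holomorphic[OF v'] hol])
      (use v in \<open>auto intro!: Moebius_function_norm_lt_1\<close>)
  then have "k holomorphic_on ball 0 1"
    unfolding k_def comp_assoc
    by (rule holomorphic_on_compose_gen[OF _ Moebius_function_holomorphic[OF g[OF v]]])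
      (use v in \<open>auto intro!: g Moebius_function_norm_lt_1\<close>)
  moreover have "cmod (k x) < 1" if "cmod x < 1" for x
    unfolding k_def comp_def
    by (intro Moebius_function_norm_lt_1 g v v' that)
  moreover have "cmod (Moebius_function 0 v u) < 1"
    by (intro Moebius_function_norm_lt_1 u v)
  ultimately have "cmod (k (Moebius_function 0 v u)) \<le> cmod (Moebius_function 0 v u)"
    using Schwarz_Lemma(1)[of k] k0 by blast
  moreover have "k (Moebius_function 0 v u) = Moebius_function 0 (g v) (g u)"
    unfolding k_def comp_def by (subst Moebius_function_compose) (use u v in auto)
  ultimately show ?thesis by (simp add: Moebius_function_simple)
qed

text \<open>The division-free form survives boundary values, such as a unimodular constant
  \<open>g\<close>: apply the strict version to \<open>t g\<close> with \<open>t < 1\<close> and let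
  \<open>t\<close> tend to 1.\<close>

lemma schwarz_pick_le:
  assumes hol: "g holomorphic_on ball 0 1" and le: "\<And>x. cmod x < 1 \<Longrightarrow> cmod (g x) \<le> 1"
    and u: "cmod u < 1" and v: "cmod v < 1"
  shows "cmod (g u - g v) \<le> cmod ((u - v) / (1 - cnj v * u)) * cmod (1 - cnj (g v) * g u)"
proof -
  let ?r = "cmod ((u - v) / (1 - cnj v * u))"
  have *: "cmod (of_real t * g u - of_real t * g v) \<le> ?r * cmod (1 - cnj (of_real t * g v) * (of_real t * g u))"
    if t: "0 < t" "t < 1" for t
  proof -
    have lt: "cmod (of_real t * g x) < 1" if "cmod x < 1" for x
    proof -
      have "t * cmod (g x) \<le> t * 1" using le[OF that] t by (intro mult_left_mono) auto
      then have "t * cmod (g x) < 1" using t by linarith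
      then show ?thesis using t by (simp add: norm_mult)
    qed
    have "cmod ((of_real t * g u - of_real t * g v) / (1 - cnj (of_real t * g v) * (of_real t * g u))) \<le> ?r"
    proof (rule schwarz_pick[OF _ _ u v])
      show "(\<lambda>x. of_real t * g x) holomorphic_on ball 0 1" by (intro holomorphic_intros hol)
      show "(\<lambda>x. of_real t * g x) ` ball 0 1 \<subseteq> ball 0 1" using lt by auto
    qed
    moreover have "1 - cnj (of_real t * g v) * (of_real t * g u) \<noteq> 0"
    proof
      assume "1 - cnj (of_real t * g v) * (of_real t * g u) = 0"
      then have "cmod (of_real t * g v) * cmod (of_real t * g u) = 1"
        by (metis complex_mod_cnj eq_iff_diff_eq_0 norm_mult norm_one)
      moreover have "cmod (of_real t * g v) * cmod (of_real t * g u) < 1 * 1"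
        using lt[OF u] lt[OF v] by (intro mult_strict_mono') auto
      ultimately show False by simp
    qed
    ultimately show ?thesis by (simp add: norm_divide divide_simps split: if_splits)
  qed
  show ?thesis
  proof (rule tendsto_le[where F = "at_left (1::real)"])
    show "((\<lambda>t. cmod (of_real t * g u - of_real t * g v)) \<longlongrightarrow> cmod (g u - g v)) (at_left 1)"
      by (auto intro!: tendsto_eq_intros)
    show "((\<lambda>t. ?r * cmod (1 - cnj (of_real t * g v) * (of_real t * g u))) \<longlongrightarrow> ?r * cmod (1 - cnj (g v) * g u)) (at_left 1)"
      by (auto intro!: tendsto_eq_intros)
    show "\<forall>\<^sub>F t in at_left 1. cmod (of_real t * g u - of_real t * g v)
        \<le> ?r * cmod (1 - cnj (of_real t * g v) * (of_real t * g u))"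
      unfolding eventually_at_left_field by (intro exI[of _ 0] conjI allI impI *) auto
  qed simp
qed

lemma moebius_lt_1:
  assumes "cmod u < 1" "cmod v < 1"
  shows "cmod ((u - v) / (1 - cnj v * u)) < 1"
  using Moebius_function_norm_lt_1[OF assms(2,1), of 0] by (simp add: Moebius_function_simple)

text \<open>A sequential form of the equality case of the Schwarz lemma. The quotients
  \<open>g n x / x\<close> are bounded by 1 and tend to 1 at \<open>s\<close>; Schwarz-Pick carries
  this to every other point.\<close>

lemma schwarz_almost_extremal:
  assumes hol: "\<And>n. g n holomorphic_on ball 0 1" and im: "\<And>n. g n ` ball 0 1 \<subseteq> ball 0 1"
    and g0: "\<And>n. g n 0 = 0" and s: "cmod s < 1" "s \<noteq> 0"
    and gs: "(\<lambda>n. g n s) \<longlonglongrightarrow> s" and u: "cmod u < 1"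
  shows "(\<lambda>n. g n u) \<longlonglongrightarrow> u"
proof -
  have "\<exists>h. h holomorphic_on ball 0 1 \<and> (\<forall>x. cmod x < 1 \<longrightarrow> g n x = x * h x \<and> cmod (h x) \<le> 1)" for n
  proof -
    obtain h where h: "h holomorphic_on ball 0 1" "\<And>x. norm x < 1 \<Longrightarrow> g n x = x * h x" "deriv (g n) 0 = h 0"
      using Schwarz3[OF hol g0] by blast
    have lt: "\<And>x. cmod x < 1 \<Longrightarrow> cmod (g n x) < 1"
      using im[of n] by (auto simp: image_subset_iff)
    have "cmod (h x) \<le> 1" if x: "cmod x < 1" for x
    proof (cases "x = 0")
      case True
      then show ?thesis using Schwarz_Lemma(2)[OF hol g0 lt x] h(3) by simp
    next
      case False
      then show ?thesis using Schwarz_Lemma(1)[OF hol g0 lt x] h(2)[OF x] by (simp add: norm_mult)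
    qed
    then show ?thesis using h by blast
  qed
  then obtain h where h: "\<And>n. h n holomorphic_on ball 0 1"
    "\<And>n x. cmod x < 1 \<Longrightarrow> g n x = x * h n x" "\<And>n x. cmod x < 1 \<Longrightarrow> cmod (h n x) \<le> 1"
    by metis
  define r where "r = cmod ((u - s) / (1 - cnj s * u))"
  have r: "r < 1" unfolding r_def by (rule moebius_lt_1[OF u s(1)])
  have "(\<lambda>n. g n s / s) \<longlonglongrightarrow> s / s" by (intro tendsto_intros gs s)
  then have hs: "(\<lambda>n. h n s) \<longlonglongrightarrow> 1" using s h(2) by simp
  \<comment> \<open>Since \<open>1 - cnj a q = (1 - |a|^2) - cnj a (q - a)\<close>, the Schwarz-Pick
    bound on \<open>|q - a|\<close> contains \<open>|q - a|\<close> again, but with the factor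
    \<open>r < 1\<close>, and absorbs it.\<close>
  have le: "cmod (h n u - h n s) \<le> (1 - (cmod (h n s))\<^sup>2) / (1 - r)" for n
  proof -
    define a q where "a = h n s" and "q = h n u"
    have a1: "cmod a \<le> 1" using h(3) s by (simp add: a_def)
    have "1 - cnj a * q = of_real (1 - (cmod a)\<^sup>2) - cnj a * (q - a)"
      using complex_norm_square[of a] by (simp add: algebra_simps)
    then have "cmod (1 - cnj a * q) \<le> cmod (of_real (1 - (cmod a)\<^sup>2)) + cmod (cnj a * (q - a))"
      by (metis norm_triangle_ineq4)
    also have "\<dots> \<le> (1 - (cmod a)\<^sup>2) + cmod (q - a)"
      unfolding norm_of_real norm_mult complex_mod_cnj
      using a1 by (intro add_mono) (auto simp: power_le_one mult_left_le_one_le)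
    finally have 1: "cmod (1 - cnj a * q) \<le> (1 - (cmod a)\<^sup>2) + cmod (q - a)" .
    have "cmod (q - a) \<le> r * cmod (1 - cnj a * q)"
      unfolding a_def q_def r_def by (rule schwarz_pick_le[OF h(1) h(3) u s(1)])
    also have "\<dots> \<le> r * ((1 - (cmod a)\<^sup>2) + cmod (q - a))"
      using 1 by (intro mult_left_mono) (auto simp: r_def)
    also have "\<dots> = r * (1 - (cmod a)\<^sup>2) + r * cmod (q - a)" by (simp add: algebra_simps)
    also have "r * (1 - (cmod a)\<^sup>2) \<le> 1 * (1 - (cmod a)\<^sup>2)"
      using r a1 by (intro mult_right_mono) (auto simp: power_le_one)
    finally have "cmod (q - a) * (1 - r) \<le> 1 - (cmod a)\<^sup>2" by (simp add: algebra_simps)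
    then show ?thesis using r by (simp add: a_def q_def pos_le_divide_eq)
  qed
  have "(\<lambda>n. (1 - (cmod (h n s))\<^sup>2) / (1 - r)) \<longlonglongrightarrow> (1 - (cmod 1)\<^sup>2) / (1 - r)"
    using r by (intro tendsto_intros hs) auto
  then have "(\<lambda>n. (1 - (cmod (h n s))\<^sup>2) / (1 - r)) \<longlonglongrightarrow> 0" by simp
  then have "(\<lambda>n. h n u - h n s) \<longlonglongrightarrow> 0"
    by (rule Lim_null_comparison[rotated]) (use le in auto)
  from tendsto_add[OF this hs] have "(\<lambda>n. h n u) \<longlonglongrightarrow> 1" by simp
  then have "(\<lambda>n. u * h n u) \<longlonglongrightarrow> u * 1" by (intro tendsto_intros)
  then show ?thesis using h(2)[OF u] by simp
qed

subsection \<open>Holomorphic maps between complex normed spaces\<close>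

lemma holomorphic_mapsI:
  assumes "\<And>x. x \<in> D \<Longrightarrow> f x \<in> E"
    and "\<And>x. x \<in> D \<Longrightarrow> \<exists>f'. bounded_clinear f' \<and> (f has_derivative f') (at x)"
  shows "f \<in> holomorphic_maps D E"
  using assms by (auto simp: holomorphic_maps_def)

lemma holomorphic_mapsD:
  assumes "f \<in> holomorphic_maps D E" "x \<in> D"
  shows "f x \<in> E" "\<exists>f'. bounded_clinear f' \<and> (f has_derivative f') (at x)"
  using assms by (auto simp: holomorphic_maps_def)

lemma bounded_clinear_compose:
  "bounded_clinear f \<Longrightarrow> bounded_clinear g \<Longrightarrow> bounded_clinear (g \<circ> f)"
  by (auto simp: bounded_clinear_def comp_def intro: bounded_linear_compose)

lemma holomorphic_maps_compose:
  assumes f: "f \<in> holomorphic_maps D E" and g: "g \<in> holomorphic_maps E F"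
  shows "g \<circ> f \<in> holomorphic_maps D F"
proof (rule holomorphic_mapsI)
  fix x assume x: "x \<in> D"
  then have fx: "f x \<in> E" by (rule holomorphic_mapsD(1)[OF f])
  then show "(g \<circ> f) x \<in> F" using holomorphic_mapsD(1)[OF g] by simp
  obtain f' g' where "bounded_clinear f'" "(f has_derivative f') (at x)"
    "bounded_clinear g'" "(g has_derivative g') (at (f x))"
    using holomorphic_mapsD(2)[OF f x] holomorphic_mapsD(2)[OF g fx] by blast
  then show "\<exists>h. bounded_clinear h \<and> (g \<circ> f has_derivative h) (at x)"
    by (intro exI[of _ "g' \<circ> f'"]) (auto intro: bounded_clinear_compose diff_chain_at)
qed

lemma holomorphic_maps_subset:
  "f \<in> holomorphic_maps D E \<Longrightarrow> (\<And>x. x \<in> D \<Longrightarrow> f x \<in> F) \<Longrightarrow> f \<in> holomorphic_maps D F"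
  by (auto simp: holomorphic_maps_def)

lemma holomorphic_maps_cong:
  assumes f: "f \<in> holomorphic_maps D E" and D: "open D" and eq: "\<And>x. x \<in> D \<Longrightarrow> f x = g x"
  shows "g \<in> holomorphic_maps D E"
proof (rule holomorphic_mapsI)
  fix x assume x: "x \<in> D"
  show "g x \<in> E" using holomorphic_mapsD(1)[OF f x] eq[OF x] by simp
  obtain f' where "bounded_clinear f'" "(f has_derivative f') (at x)"
    using holomorphic_mapsD(2)[OF f x] by blast
  then show "\<exists>g'. bounded_clinear g' \<and> (g has_derivative g') (at x)"
    using has_derivative_transform_within_open[of f f' x UNIV D g] D x eq by auto
qed

lemma holomorphic_maps_clinear:
  "bounded_clinear f \<Longrightarrow> f \<in> holomorphic_maps D UNIV"
  by (rule holomorphic_mapsI) (auto simp: bounded_clinear_def bounded_linear_imp_has_derivative)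

lemma holomorphic_maps_const:
  "(\<lambda>_. c :: complex) \<in> holomorphic_maps D UNIV"
  by (rule holomorphic_mapsI) (auto simp: bounded_clinear_complex_iff intro!: exI[of _ "\<lambda>_. 0"])

lemma holomorphic_maps_add:
  fixes f g :: "'a::complex_normed_vector \<Rightarrow> complex"
  assumes f: "f \<in> holomorphic_maps D UNIV" and g: "g \<in> holomorphic_maps D UNIV"
  shows "(\<lambda>x. f x + g x) \<in> holomorphic_maps D UNIV"
proof (rule holomorphic_mapsI)
  fix x assume x: "x \<in> D"
  obtain f' g' where "bounded_clinear f'" "(f has_derivative f') (at x)"
    "bounded_clinear g'" "(g has_derivative g') (at x)"
    using holomorphic_mapsD(2)[OF f x] holomorphic_mapsD(2)[OF g x] by blast
  then show "\<exists>h. bounded_clinear h \<and> ((\<lambda>x. f x + g x) has_derivative h) (at x)"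
    by (intro exI[of _ "\<lambda>y. f' y + g' y"])
      (auto simp: bounded_clinear_complex_iff bounded_linear_add algebra_simps intro: has_derivative_add)
qed simp

lemma holomorphic_maps_mult:
  fixes f g :: "'a::complex_normed_vector \<Rightarrow> complex"
  assumes f: "f \<in> holomorphic_maps D UNIV" and g: "g \<in> holomorphic_maps D UNIV"
  shows "(\<lambda>x. f x * g x) \<in> holomorphic_maps D UNIV"
proof (rule holomorphic_mapsI)
  fix x assume x: "x \<in> D"
  obtain f' g' where *: "bounded_clinear f'" "(f has_derivative f') (at x)"
    "bounded_clinear g'" "(g has_derivative g') (at x)"
    using holomorphic_mapsD(2)[OF f x] holomorphic_mapsD(2)[OF g x] by blast
  then have d: "((\<lambda>x. f x * g x) has_derivative (\<lambda>y. f x * g' y + f' y * g x)) (at x)"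
    by (intro has_derivative_mult)
  moreover have "bounded_clinear (\<lambda>y. f x * g' y + f' y * g x)"
    using has_derivative_bounded_linear[OF d] * by (simp add: bounded_clinear_complex_iff algebra_simps)
  ultimately show "\<exists>h. bounded_clinear h \<and> ((\<lambda>x. f x * g x) has_derivative h) (at x)" by blast
qed simp

lemma bounded_clinear_scaleC_left: "bounded_clinear (\<lambda>c. c *\<^sub>C x)"
proof -
  have "bounded_linear (\<lambda>c. c *\<^sub>C x)"
    by (rule bounded_linear_intro[where K = "norm x"])
      (simp_all add: scaleC_add_left norm_scaleC scaleC_of_real[of _ x, symmetric] scaleC_scaleC
        scaleR_conv_of_real scaleC_of_real[of _ "_ *\<^sub>C x", symmetric])
  then show ?thesis
    by (simp add: bounded_clinear_def scaleC_complex_def scaleC_scaleC)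
qed

text \<open>Restrict \<open>f\<close> to the complex line through \<open>p / r\<close>, where
  \<open>p\<close> sits at parameter \<open>r\<close>. A radius strictly above \<open>norm p\<close>
  keeps the slice inside the ball and also covers \<open>p = 0\<close>.\<close>

lemma ball_schwarz_pick_0:
  assumes f: "f \<in> holomorphic_maps (ball (0::'a::complex_normed_vector) 1) unit_disc"
    and p: "norm p < r" and r: "r < 1"
  shows "cmod ((f p - f 0) / (1 - cnj (f 0) * f p)) \<le> r"
proof -
  have r0: "0 < r" using p norm_ge_zero[of p] by linarith
  define q where "q = inverse (of_real r) *\<^sub>C p"
  have q: "norm q < 1" using p r0 by (simp add: q_def norm_scaleC norm_inverse) (simp add: field_simps)
  define k where "k = f \<circ> (\<lambda>c. c *\<^sub>C q)"
  have "cmod c * norm q < 1" if "cmod c < 1" for c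
    using that q mult_strict_mono'[of "cmod c" 1 "norm q" 1] by simp
  then have "(\<lambda>c. c *\<^sub>C q) \<in> holomorphic_maps unit_disc (ball 0 1)"
    by (intro holomorphic_maps_subset[OF holomorphic_maps_clinear[OF bounded_clinear_scaleC_left]])
      (simp add: norm_scaleC)
  then have "k \<in> holomorphic_maps unit_disc unit_disc"
    unfolding k_def using f by (rule holomorphic_maps_compose)
  then have "k holomorphic_on unit_disc" "k ` unit_disc \<subseteq> unit_disc"
    by (simp_all add: holomorphic_maps_complex_iff)
  from schwarz_pick[OF this, of "of_real r" 0]
  have "cmod ((k (of_real r) - k 0) / (1 - cnj (k 0) * k (of_real r))) \<le> r"
    using r r0 by simp
  moreover have "of_real r *\<^sub>C q = p"
    using r0 scaleC_of_real[of 1 p] by (simp add: q_def scaleC_scaleC)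
  moreover have "0 *\<^sub>C q = 0"
    using scaleC_of_real[of 0 q] by simp
  ultimately show ?thesis by (simp add: k_def)
qed

text \<open>In \<open>|1 - cnj y x|^2 - |x - y|^2 = (1 - |x|^2) (1 - |y|^2)\<close> the left side is
  at least \<open>(1 - r^2) |1 - cnj y x|^2\<close>, and
  \<open>|1 - cnj y x| \<ge> 1 - r\<close>.\<close>

lemma norm_le_of_moebius_le:
  assumes y: "cmod y \<le> r" and x: "cmod x < 1" and r: "r < 1"
    and le: "cmod ((x - y) / (1 - cnj y * x)) \<le> r"
  shows "(cmod x)\<^sup>2 \<le> 1 - (1 - r\<^sup>2) * (1 - r)\<^sup>2"
proof -
  have r0: "0 \<le> r" using y norm_ge_zero order_trans by blast
  have "cmod (cnj y * x) \<le> r * 1"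
    unfolding norm_mult using y x r0 by (intro mult_mono) auto
  then have d: "1 - r \<le> cmod (1 - cnj y * x)"
    using norm_triangle_ineq2[of 1 "cnj y * x"] by simp
  then have pos: "cmod (1 - cnj y * x) > 0" using r by linarith
  then have "cmod (x - y) \<le> r * cmod (1 - cnj y * x)"
    using le by (simp add: norm_divide pos_divide_le_eq)
  then have "(cmod (x - y))\<^sup>2 \<le> (r * cmod (1 - cnj y * x))\<^sup>2"
    by (intro power_mono) auto
  then have 1: "(cmod (x - y))\<^sup>2 \<le> r\<^sup>2 * (cmod (1 - cnj y * x))\<^sup>2" by (simp add: power_mult_distrib)
  have "complex_of_real ((cmod (1 - cnj y * x))\<^sup>2 - (cmod (x - y))\<^sup>2)
      = of_real ((1 - (cmod x)\<^sup>2) * (1 - (cmod y)\<^sup>2))"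
    unfolding of_real_diff of_real_mult complex_norm_square by (simp add: algebra_simps)
  then have id: "(cmod (1 - cnj y * x))\<^sup>2 - (cmod (x - y))\<^sup>2 = (1 - (cmod x)\<^sup>2) * (1 - (cmod y)\<^sup>2)"
    unfolding of_real_eq_iff .
  have r2: "r\<^sup>2 < 1" using r r0 by (simp add: power_less_one_iff)
  have "(1 - r\<^sup>2) * (1 - r)\<^sup>2 \<le> (1 - r\<^sup>2) * (cmod (1 - cnj y * x))\<^sup>2"
    using d r r2 by (intro mult_left_mono power_mono) auto
  also have "\<dots> \<le> (1 - (cmod x)\<^sup>2) * (1 - (cmod y)\<^sup>2)"
    using 1 id by (simp add: algebra_simps)
  also have "\<dots> \<le> (1 - (cmod x)\<^sup>2) * 1"
    using x by (intro mult_left_mono) (auto simp: power_le_one)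
  finally show ?thesis by simp
qed

text \<open>The comparison goes through the centre: \<open>f z = 0\<close> bounds
  \<open>f 0\<close>, and that bounds \<open>f w\<close>, uniformly in \<open>f\<close>. Hence the
  supremum \<open>s\<close> stays below 1.\<close>

lemma ball_extremal_value_lt_1:
  assumes z: "norm (z::'a::complex_normed_vector) < 1" and w: "norm w < 1"
  shows "\<exists>c<1. \<forall>f\<in>holomorphic_maps (ball 0 1) unit_disc. f z = 0 \<longrightarrow> cmod (f w) \<le> c"
proof -
  obtain r where r: "max (norm z) (norm w) < r" "r < 1"
    using dense[of "max (norm z) (norm w)" 1] z w by auto
  define d where "d = (1 - r\<^sup>2) * (1 - r)\<^sup>2"
  have "0 < r" using r norm_ge_zero[of z] by linarith
  then have d: "d > 0" using r by (simp add: d_def power_less_one_iff)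
  show ?thesis
  proof (intro exI[of _ "sqrt (1 - d)"] conjI ballI impI)
    show "sqrt (1 - d) < 1" using d by simp
    fix f :: "'a \<Rightarrow> complex" assume f: "f \<in> holomorphic_maps (ball 0 1) unit_disc" and fz: "f z = 0"
    have "cmod (f 0) \<le> r"
      using ball_schwarz_pick_0[OF f, of z r] r fz by simp
    moreover have "cmod (f w) < 1" using holomorphic_mapsD(1)[OF f, of w] w by simp
    ultimately have "(cmod (f w))\<^sup>2 \<le> 1 - d"
      unfolding d_def using ball_schwarz_pick_0[OF f, of w r] r
      by (intro norm_le_of_moebius_le[of "f 0"]) auto
    then show "cmod (f w) \<le> sqrt (1 - d)" by (rule real_le_rsqrt)
  qed
qed

subsection \<open>The bidual\<close>

lemma cdual_apply_linear:
  "cdual_apply l (x + y) = cdual_apply l x + cdual_apply l y"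
  "cdual_apply l (x - y) = cdual_apply l x - cdual_apply l y"
  "cdual_apply l (c *\<^sub>C x) = c * cdual_apply l x"
  "cdual_apply l 0 = 0"
proof -
  have "bounded_linear (cdual_apply l)" and *: "\<forall>c x. cdual_apply l (c *\<^sub>C x) = c * cdual_apply l x"
    using bounded_clinear_cdual_apply[of l] by (auto simp: bounded_clinear_complex_iff)
  then interpret bounded_linear "cdual_apply l" by simp
  show "cdual_apply l (x + y) = cdual_apply l x + cdual_apply l y"
    "cdual_apply l (x - y) = cdual_apply l x - cdual_apply l y"
    "cdual_apply l (c *\<^sub>C x) = c * cdual_apply l x" "cdual_apply l 0 = 0"
    using * by (simp_all add: add diff zero)
qed

lemma cdual_eqI: "(\<And>x. cdual_apply l x = cdual_apply m x) \<Longrightarrow> l = m"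
  by (simp add: cdual_apply_inject[symmetric] fun_eq_iff)

lemma norm_cdual_le:
  assumes "C \<ge> 0" "\<And>x. cmod (cdual_apply l x) \<le> C * norm x"
  shows "norm l \<le> C"
  unfolding norm_cdual.rep_eq using assms by (rule onorm_bound)

lemma Abs_cdual_apply:
  fixes l :: "'a::complex_normed_vector \<Rightarrow> complex"
  assumes "\<And>x y. l (x + y) = l x + l y" "\<And>c x. l (c *\<^sub>C x) = c * l x" "\<And>x. cmod (l x) \<le> C * norm x"
  shows "cdual_apply (Abs_cdual l) = l"
proof -
  have "bounded_linear l"
    by (rule bounded_linear_intro[where K = C])
      (use assms in \<open>auto simp: scaleC_of_real[of _ "_ :: 'a", symmetric] scaleR_conv_of_real mult.commute\<close>)
  then show ?thesis
    using assms by (intro Abs_cdual_inverse) (simp add: bounded_clinear_complex_iff)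
qed

lemma norming_functional:
  fixes x :: "'a::complex_normed_vector"
  obtains l :: "'a cdual" where "norm l \<le> 1" "cdual_apply l x = of_real (norm x)"
proof (cases "x = 0")
  case True
  then show ?thesis using that[of 0] by (simp add: zero_cdual.rep_eq)
next
  case False
  interpret vector_space "scaleC :: complex \<Rightarrow> 'a \<Rightarrow> 'a"
    using scaleC_of_real[of 1]
    by unfold_locales (simp_all add: scaleC_add_right scaleC_add_left scaleC_scaleC)
  define L where "L = (\<lambda>y. (THE c. y = c *\<^sub>C x) * of_real (norm x))"
  have L: "L (c *\<^sub>C x) = c * of_real (norm x)" for c
    using False by (simp add: L_def scale_cancel_right)
  define W where "W = range (\<lambda>c. c *\<^sub>C x)"
  obtain F :: "'a \<Rightarrow> complex" where
    F: "\<And>x y. x \<in> UNIV \<Longrightarrow> y \<in> UNIV \<Longrightarrow> F (x + y) = F x + F y"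
    "\<And>c x. x \<in> UNIV \<Longrightarrow> F (c *\<^sub>C x) = c * F x"
    "\<And>x. x \<in> UNIV \<Longrightarrow> cmod (F x) \<le> norm x"
    "\<And>x. x \<in> W \<Longrightarrow> F x = L x"
  proof (rule hahn_banach_complex[OF vector_space_axioms scaleC_of_real subspace_UNIV _ subset_UNIV, of W norm L])
    show "subspace W"
      unfolding subspace_def W_def
      by (auto simp: scaleC_scaleC scaleC_add_left[symmetric] intro: range_eqI[of _ _ 0])
    show "L (x + y) = L x + L y" if "x \<in> W" "y \<in> W" for x y
      using that by (auto simp: W_def scaleC_add_left[symmetric] L distrib_right)
    show "L (c *\<^sub>C x) = c * L x" if "x \<in> W" for c x
      using that by (auto simp: W_def scaleC_scaleC L)
    show "cmod (L x) \<le> norm x" if "x \<in> W" for x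
      using that by (auto simp: W_def L norm_mult norm_scaleC)
  qed (auto simp: norm_triangle_ineq norm_scaleC)
  have ap: "cdual_apply (Abs_cdual F) = F"
    by (rule Abs_cdual_apply[of _ 1]) (use F in auto)
  have "x \<in> W" using scale_one[of x] unfolding W_def by (metis rangeI)
  then have "F x = of_real (norm x)"
    using F(4) L[of 1] by simp
  moreover have "norm (Abs_cdual F) \<le> 1"
    by (rule norm_cdual_le) (use ap F in auto)
  ultimately show ?thesis using that ap by metis
qed

lemma cdual_apply_bidual_embed: "cdual_apply (bidual_embed x) l = cdual_apply l x"
  by (simp add: bidual_embed.rep_eq)

lemma bidual_embed_linear:
  "bidual_embed (x + y) = bidual_embed x + bidual_embed y"
  "bidual_embed (x - y) = bidual_embed x - bidual_embed y"
  "bidual_embed (c *\<^sub>C x) = c *\<^sub>C bidual_embed x"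
  by (rule cdual_eqI; simp add: cdual_apply_bidual_embed plus_cdual.rep_eq minus_cdual.rep_eq
      scaleC_cdual.rep_eq cdual_apply_linear)+

lemma norm_bidual_embed: "norm (bidual_embed x) = norm x"
proof (rule antisym)
  show "norm (bidual_embed x) \<le> norm x"
    by (rule norm_cdual_le)
      (use norm_cdual_apply_le in \<open>auto simp: cdual_apply_bidual_embed mult.commute\<close>)
  obtain l :: "'a cdual" where l: "norm l \<le> 1" "cdual_apply l x = of_real (norm x)"
    by (rule norming_functional)
  have "norm x = cmod (cdual_apply (bidual_embed x) l)"
    by (simp add: cdual_apply_bidual_embed l)
  also have "\<dots> \<le> norm (bidual_embed x) * norm l" by (rule norm_cdual_apply_le)
  also have "\<dots> \<le> norm (bidual_embed x)" using l by (simp add: mult_left_le)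
  finally show "norm x \<le> norm (bidual_embed x)" .
qed

subsection \<open>The extremal disc in the ball\<close>

lemma has_derivative_of_quadratic_remainder:
  fixes \<phi> :: "complex \<Rightarrow> 'a::complex_normed_vector"
  assumes d: "0 < d"
    and le: "\<And>h. cmod h \<le> d \<Longrightarrow> norm (\<phi> (u + h) - \<phi> u - h *\<^sub>C x) \<le> K * (cmod h)\<^sup>2"
  shows "(\<phi> has_derivative (\<lambda>h. h *\<^sub>C x)) (at u)"
  unfolding has_derivative_at
proof
  show "bounded_linear (\<lambda>h. h *\<^sub>C x)"
    using bounded_clinear_scaleC_left[of x] by (simp add: bounded_clinear_def)
  show "(\<lambda>h. norm (\<phi> (u + h) - \<phi> u - h *\<^sub>C x) / norm h) \<midarrow>0\<rightarrow> 0"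
  proof (rule Lim_null_comparison)
    have "\<forall>\<^sub>F h in at 0. cmod h < d"
      using d unfolding eventually_at by (auto simp: dist_norm)
    then show "\<forall>\<^sub>F h in at 0. norm (norm (\<phi> (u + h) - \<phi> u - h *\<^sub>C x) / norm h) \<le> K * cmod h"
    proof eventually_elim
      case (elim h)
      then show ?case
        using le[of h] by (cases "h = 0") (auto simp: divide_simps power2_eq_square mult.assoc)
    qed
    have "((\<lambda>h. K * cmod h) \<longlongrightarrow> K * cmod 0) (at 0)" by (intro tendsto_intros)
    then show "((\<lambda>h. K * cmod h) \<longlongrightarrow> 0) (at 0)" by simp
  qed
qed

section \<open>The extremal problem on the ball\<close>

lemma ball_extremal_value_pos:
  fixes z w :: "'a::complex_normed_vector"
  assumes z: "norm z < 1" and zw: "z \<noteq> w"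
  obtains f where "f \<in> holomorphic_maps (ball 0 1) unit_disc" "f z = 0" "f w \<noteq> 0"
proof -
  obtain l :: "'a cdual" where l: "norm l \<le> 1" "cdual_apply l (w - z) = of_real (norm (w - z))"
    by (rule norming_functional)
  \<comment> \<open>Two points of the ball are less than 2 apart, whence the factor 1/2.\<close>
  define f where "f = (\<lambda>x. (1 / 2) * (cdual_apply l x + - cdual_apply l z))"
  have "cmod (f x) < 1" if "norm x < 1" for x
  proof -
    have "cmod (f x) = cmod (cdual_apply l (x - z)) / 2"
      by (simp add: f_def norm_mult cdual_apply_linear)
    also have "cmod (cdual_apply l (x - z)) \<le> norm l * norm (x - z)" by (rule norm_cdual_apply_le)
    also have "\<dots> \<le> norm (x - z)" using l(1) by (simp add: mult_left_le_one_le)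
    also have "\<dots> \<le> norm x + norm z" by (rule norm_triangle_ineq4)
    finally show ?thesis using that z by simp
  qed
  moreover have "f \<in> holomorphic_maps (ball 0 1) UNIV"
    unfolding f_def
    by (intro holomorphic_maps_mult holomorphic_maps_add holomorphic_maps_const
        holomorphic_maps_clinear bounded_clinear_cdual_apply)
  ultimately have "f \<in> holomorphic_maps (ball 0 1) unit_disc"
    using holomorphic_maps_subset[of f "ball 0 1" UNIV unit_disc] by auto
  moreover have "f w \<noteq> 0"
    using l(2) zw by (simp add: f_def cdual_apply_linear)
  moreover have "f z = 0" by (simp add: f_def)
  ultimately show ?thesis using that by blast
qed

lemma ball_extremal_sequence:
  fixes z w :: "'a::complex_normed_vector"
  assumes z: "norm z < 1" and w: "norm w < 1" and zw: "z \<noteq> w"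
  obtains s F where "0 < s" "s < 1"
    "\<And>n. F n \<in> holomorphic_maps (ball 0 1) unit_disc" "\<And>n. F n z = 0"
    "(\<lambda>n::nat. F n w) \<longlonglongrightarrow> complex_of_real s"
    "\<And>f. f \<in> holomorphic_maps (ball 0 1) unit_disc \<Longrightarrow> f z = 0 \<Longrightarrow> cmod (f w) \<le> s"
proof -
  define H where "H = {f \<in> holomorphic_maps (ball 0 1) unit_disc. f z = 0}"
  define s where "s = (SUP f\<in>H. cmod (f w))"
  obtain c where c1: "c < 1" and c: "\<And>f. f \<in> H \<Longrightarrow> cmod (f w) \<le> c"
    using ball_extremal_value_lt_1[OF z w] by (auto simp: H_def)
  obtain f0 where f0: "f0 \<in> H" "f0 w \<noteq> 0"
    by (rule ball_extremal_value_pos[OF z zw]) (auto simp: H_def)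
  have le: "cmod (f w) \<le> s" if "f \<in> H" for f
    unfolding s_def using that c by (intro cSUP_upper bdd_aboveI2[of _ _ c]) auto
  have "s \<le> c"
    unfolding s_def using f0 c by (intro cSUP_least) auto
  then have s1: "s < 1" using c1 by simp
  have s0: "s > 0" using le[OF f0(1)] f0(2) by (meson less_le_trans zero_less_norm_iff)
  have "\<exists>f\<in>H. cmod (f w - s) \<le> 1 / Suc n" for n
  proof -
    have "s - 1 / Suc n < s" by simp
    then obtain f where f: "f \<in> H" "s - 1 / Suc n < cmod (f w)"
      using less_cSUP_iff[of H "\<lambda>f. cmod (f w)"] c f0 unfolding s_def
      by (metis bdd_aboveI2 empty_iff)
    \<comment> \<open>Rotating each function makes the values at \<open>w\<close> themselves
      converge to \<open>s\<close>, not just their moduli.\<close>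
    obtain a where a: "cmod a = 1" "a * f w = of_real (cmod (f w))"
      by (rule unimodular_rotation)
    have fD: "f \<in> holomorphic_maps (ball 0 1) unit_disc" and fz: "f z = 0"
      using f(1) by (auto simp: H_def)
    have fhol: "f \<in> holomorphic_maps (ball 0 1) UNIV"
      by (rule holomorphic_maps_subset[OF fD]) simp
    have fb: "cmod (f x) < 1" if "norm x < 1" for x
      using holomorphic_mapsD(1)[OF fD, of x] that by simp
    have "(\<lambda>x. a * f x) \<in> holomorphic_maps (ball 0 1) unit_disc"
      by (rule holomorphic_maps_subset[OF holomorphic_maps_mult[OF holomorphic_maps_const fhol]])
        (simp add: norm_mult a fb)
    then have "(\<lambda>x. a * f x) \<in> H" using fz by (simp add: H_def)
    moreover have "cmod (of_real (cmod (f w)) - of_real s) \<le> 1 / Suc n"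
      unfolding of_real_diff[symmetric] norm_of_real using le[OF f(1)] f(2) by simp
    ultimately show ?thesis using a(2) by (metis (mono_tags, lifting))
  qed
  then obtain F :: "nat \<Rightarrow> 'a \<Rightarrow> complex"
    where F: "\<And>n. F n \<in> H" "\<And>n. cmod (F n w - s) \<le> 1 / Suc n" by metis
  have "(\<lambda>n. F n w - s) \<longlonglongrightarrow> 0"
    using F(2) by (intro Lim_null_comparison[OF _ LIMSEQ_Suc[OF lim_1_over_n]]) auto
  then have "(\<lambda>n. F n w) \<longlonglongrightarrow> s" by (simp add: LIM_zero_iff)
  with s0 s1 show ?thesis
    using F(1) le by (intro that[of s F]) (auto simp: H_def)
qed

text \<open>Convergence at \<open>z\<close> and \<open>w\<close> makes the two limits algebra
  homomorphisms. Outside the ball only boundedness is asked, so functions are extended by 0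
  there.\<close>

definition bounded_sequences ::
    "'a::complex_normed_vector \<Rightarrow> 'a \<Rightarrow> (nat \<times> 'a \<Rightarrow> complex) set"
  where "bounded_sequences z w = {g. bounded_fun g \<and>
    (\<forall>n. (\<lambda>x. g (n, x)) \<in> holomorphic_maps (ball 0 1) UNIV) \<and>
    convergent (\<lambda>n. g (n, z)) \<and> convergent (\<lambda>n. g (n, w))}"

lemma bounded_sequences_extremal_pair:
  fixes z w :: "'a::complex_normed_vector" and F :: "nat \<Rightarrow> 'a \<Rightarrow> complex"
  assumes z: "norm z < 1" and w: "norm w < 1" and s: "0 < s" "s < 1"
    and F: "\<And>n. F n \<in> holomorphic_maps (ball 0 1) unit_disc" and Fz: "\<And>n. F n z = 0"
    and Fw: "(\<lambda>n. F n w) \<longlonglongrightarrow> complex_of_real s"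
    and ext: "\<And>f. f \<in> holomorphic_maps (ball 0 1) unit_disc \<Longrightarrow> f z = 0 \<Longrightarrow> cmod (f w) \<le> s"
  shows "extremal_pair (bounded_sequences z w) (\<lambda>(n, x). if norm x < 1 then F n x else 0)
    (\<lambda>g. lim (\<lambda>n. g (n, z))) (\<lambda>g. lim (\<lambda>n. g (n, w))) s"
proof -
  define f where "f = (\<lambda>(n, x). if norm x < 1 then F n x else 0)"
  have Fhol: "F n \<in> holomorphic_maps (ball 0 1) UNIV" for n
    using F[of n] by (auto simp: holomorphic_maps_def)
  have Fb: "cmod (F n x) < 1" if "norm x < 1" for n x
    using F[of n] that by (auto simp: holomorphic_maps_def image_subset_iff)
  have fle: "cmod (f \<omega>) < 1" for \<omega>
    using Fb by (auto simp: f_def split: prod.splits)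
  have fhol: "(\<lambda>x. f (n, x)) \<in> holomorphic_maps (ball 0 1) UNIV" for n
    by (rule holomorphic_maps_cong[OF Fhol[of n]]) (auto simp: f_def)
  have fz: "f (n, z) = 0" and fw: "(\<lambda>n. f (n, w)) \<longlonglongrightarrow> s" for n
    using z w Fz Fw by (simp_all add: f_def)
  \<comment> \<open>\<open>C\<close> may be 0 or be attained, so \<open>g / C\<close> need not map
    into the open disc; dividing by \<open>D > C\<close> and letting \<open>D\<close> tend to
    \<open>C\<close> handles both cases.\<close>
  have norm_ext: "cmod (g w) \<le> s * C"
    if g: "g \<in> holomorphic_maps (ball 0 1) UNIV" "g z = 0" and C: "\<And>x. norm x < 1 \<Longrightarrow> cmod (g x) \<le> C" for g C
  proof -
    have C0: "0 \<le> C" using order_trans[OF norm_ge_zero C[of 0]] by simp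
    have "cmod (g w) / s \<le> D" if D: "C < D" for D
    proof -
      have D0: "0 < D" using C0 D by simp
      have "inverse (of_real D) * g x \<in> unit_disc" if "x \<in> ball 0 1" for x
        using C[of x] that D D0 by (simp add: norm_mult norm_inverse norm_divide divide_simps)
      then have "(\<lambda>x. inverse (of_real D) * g x) \<in> holomorphic_maps (ball 0 1) unit_disc"
        by (rule holomorphic_maps_subset[OF holomorphic_maps_mult[OF holomorphic_maps_const g(1)]])
      from ext[OF this] have "cmod (g w) \<le> s * D"
        using D0 g(2) by (simp add: norm_mult norm_inverse norm_divide field_simps)
      then show ?thesis using s by (simp add: field_simps)
    qed
    then have "cmod (g w) / s \<le> C" by (rule dense_ge)
    then show ?thesis using s by (simp add: field_simps)
  qed
  show ?thesis
    unfolding f_def[symmetric]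
  proof
    fix g h :: "nat \<times> 'a \<Rightarrow> complex"
    assume g: "g \<in> bounded_sequences z w" and h: "h \<in> bounded_sequences z w"
    then show "(\<lambda>\<omega>. g \<omega> + h \<omega>) \<in> bounded_sequences z w" "(\<lambda>\<omega>. g \<omega> * h \<omega>) \<in> bounded_sequences z w"
      by (auto simp: bounded_sequences_def bounded_fun_intros holomorphic_maps_add holomorphic_maps_mult
          convergent_add convergent_mult)
    show "lim (\<lambda>n. g (n, z) + h (n, z)) = lim (\<lambda>n. g (n, z)) + lim (\<lambda>n. h (n, z))"
      "lim (\<lambda>n. g (n, w) + h (n, w)) = lim (\<lambda>n. g (n, w)) + lim (\<lambda>n. h (n, w))"
      "lim (\<lambda>n. g (n, z) * h (n, z)) = lim (\<lambda>n. g (n, z)) * lim (\<lambda>n. h (n, z))"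
      "lim (\<lambda>n. g (n, w) * h (n, w)) = lim (\<lambda>n. g (n, w)) * lim (\<lambda>n. h (n, w))"
      using g h by (auto simp: bounded_sequences_def convergent_LIMSEQ_iff intro!: limI tendsto_add tendsto_mult)
  next
    fix g :: "nat \<times> 'a \<Rightarrow> complex" and C
    assume g: "g \<in> bounded_sequences z w" and g0: "lim (\<lambda>n. g (n, z)) = 0"
      and C: "\<And>\<omega>. cmod (g \<omega>) \<le> C"
    have gz: "(\<lambda>n. g (n, z)) \<longlonglongrightarrow> 0" and gw: "(\<lambda>n. g (n, w)) \<longlonglongrightarrow> lim (\<lambda>n. g (n, w))"
      using g g0 by (auto simp: bounded_sequences_def convergent_LIMSEQ_iff)
    \<comment> \<open>The single functions vanish at \<open>z\<close> only in the limit. Subtracting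
      \<open>g (n, z)\<close> makes them admissible, at the cost of an error that tends to
      0.\<close>
    have "cmod (g (n, w) + - g (n, z)) \<le> s * (C + cmod (g (n, z)))" for n
    proof (rule norm_ext)
      show "(\<lambda>x. g (n, x) + - g (n, z)) \<in> holomorphic_maps (ball 0 1) UNIV"
        using g by (intro holomorphic_maps_add holomorphic_maps_const) (simp add: bounded_sequences_def)
      show "cmod (g (n, x) + - g (n, z)) \<le> C + cmod (g (n, z))" for x
        using norm_triangle_ineq[of "g (n, x)" "- g (n, z)"] C[of "(n, x)"] by simp
    qed simp
    moreover have "(\<lambda>n. cmod (g (n, w) + - g (n, z))) \<longlonglongrightarrow> cmod (lim (\<lambda>n. g (n, w)) + - 0)"
      by (intro tendsto_intros gw gz)
    moreover have "(\<lambda>n. s * (C + cmod (g (n, z)))) \<longlonglongrightarrow> s * (C + cmod 0)"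
      by (intro tendsto_intros gz)
    ultimately show "cmod (lim (\<lambda>n. g (n, w))) \<le> s * C"
      using LIMSEQ_le[of "\<lambda>n. cmod (g (n, w) + - g (n, z))" _ "\<lambda>n. s * (C + cmod (g (n, z)))"] by simp
  next
    fix u :: complex assume u: "cmod u < 1"
    have lt: "cmod (u * f \<omega>) \<le> cmod u" for \<omega>
      unfolding norm_mult using fle[of \<omega>] by (intro mult_left_le) auto
    have ge: "1 - cmod u \<le> cmod (1 - u * f \<omega>)" for \<omega>
      using norm_triangle_ineq2[of 1 "u * f \<omega>"] lt[of \<omega>] by simp
    have nz: "u * f \<omega> \<noteq> 1" for \<omega> using lt[of \<omega>] u by force
    have "bounded_fun (\<lambda>\<omega>. 1 / (1 - u * f \<omega>))"
      by (rule bounded_funI[of _ "1 / (1 - cmod u)"])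
        (use ge u in \<open>auto simp: norm_divide intro!: divide_left_mono mult_pos_pos order_less_le_trans[OF _ ge]\<close>)
    moreover have "(\<lambda>x. 1 / (1 - u * f (n, x))) \<in> holomorphic_maps (ball 0 1) UNIV" for n
    proof -
      have "(\<lambda>y. 1 / (1 - u * y)) holomorphic_on unit_disc"
      proof (intro holomorphic_intros)
        fix y :: complex assume "y \<in> unit_disc"
        then have "cmod (u * y) \<le> cmod u" unfolding norm_mult by (intro mult_left_le) auto
        then show "1 - u * y \<noteq> 0" using u by force
      qed
      then have "(\<lambda>y. 1 / (1 - u * y)) \<in> holomorphic_maps unit_disc UNIV"
        by (simp add: holomorphic_maps_complex_iff)
      moreover have "(\<lambda>x. f (n, x)) \<in> holomorphic_maps (ball 0 1) unit_disc"
        using fle by (intro holomorphic_maps_subset[OF fhol]) simp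
      ultimately have "(\<lambda>y. 1 / (1 - u * y)) \<circ> (\<lambda>x. f (n, x)) \<in> holomorphic_maps (ball 0 1) UNIV"
        by (intro holomorphic_maps_compose)
      then show ?thesis by (simp add: comp_def)
    qed
    moreover have "convergent (\<lambda>n. 1 / (1 - u * f (n, z)))" by (simp add: fz convergent_const)
    moreover have "1 - u * of_real s \<noteq> 0"
    proof -
      have "cmod (u * of_real s) < 1 * 1"
        unfolding norm_mult using u s by (intro mult_strict_mono') auto
      then show ?thesis by force
    qed
    then have "convergent (\<lambda>n. 1 / (1 - u * f (n, w)))"
      by (intro convergentI[of _ "1 / (1 - u * of_real s)"] tendsto_intros fw)
    ultimately show "(\<lambda>\<omega>. 1 / (1 - u * f \<omega>)) \<in> bounded_sequences z w"
      by (simp add: bounded_sequences_def)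
  next
    show "f \<in> bounded_sequences z w"
      using fhol fz convergentI[OF fw] bounded_funI[OF less_imp_le[OF fle]]
      by (simp add: bounded_sequences_def convergent_const)
    show "lim (\<lambda>n. f (n, w)) = s" by (rule limI[OF fw])
  qed (use fz fle s in \<open>auto simp: bounded_sequences_def bounded_fun_intros holomorphic_maps_const
      convergent_const less_imp_le\<close>)
qed

text \<open>For fixed \<open>u\<close>, \<open>disc u\<close> is evaluated at linear functionals
  only, which makes it an element of the bidual. Bounds that are uniform over functionals of given
  norm become norm bounds there.\<close>

lemma ball_extremal_bidual_disc:
  fixes z w :: "'a::complex_normed_vector"
  assumes z: "norm z < 1" and w: "norm w < 1" and zw: "z \<noteq> w"
  obtains s F and \<phi> \<phi>' :: "complex \<Rightarrow> 'a cdual cdual" where "0 < s" "s < 1"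
    "\<And>n. F n \<in> holomorphic_maps (ball 0 1) unit_disc" "\<And>n. F n z = 0"
    "(\<lambda>n::nat. F n w) \<longlonglongrightarrow> complex_of_real s"
    "\<phi> 0 = bidual_embed z" "\<phi> (of_real s) = bidual_embed w"
    "\<And>u. cmod u < 1 \<Longrightarrow> norm (\<phi> u) < 1"
    "\<And>u h. cmod u < 1 \<Longrightarrow> cmod h \<le> (1 - cmod u) / 2 \<Longrightarrow>
      norm (\<phi> (u + h) - \<phi> u - h *\<^sub>C \<phi>' u) \<le> 8 / ((1 - s\<^sup>2) * (1 - cmod u) ^ 3) * (cmod h)\<^sup>2"
proof -
  obtain s F where s: "0 < s" "s < 1"
    and F: "\<And>n. F n \<in> holomorphic_maps (ball (0::'a) 1) unit_disc" "\<And>n. F n z = 0"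
    and Fw: "(\<lambda>n::nat. F n w) \<longlonglongrightarrow> complex_of_real s"
    and ext: "\<And>f. f \<in> holomorphic_maps (ball 0 1) unit_disc \<Longrightarrow> f z = 0 \<Longrightarrow> cmod (f w) \<le> s"
    by (rule ball_extremal_sequence[OF z w zw]) blast
  define f where "f = (\<lambda>(n, x). if norm x < 1 then F n x else 0)"
  interpret extremal_pair "bounded_sequences z w" f
      "\<lambda>g. lim (\<lambda>n. g (n, z))" "\<lambda>g. lim (\<lambda>n. g (n, w))" s
    unfolding f_def by (rule bounded_sequences_extremal_pair) (fact z w s F Fw | erule (1) ext)+
  obtain M where "extremal_state (bounded_sequences z w) f
      (\<lambda>g. lim (\<lambda>n. g (n, z))) (\<lambda>g. lim (\<lambda>n. g (n, w))) s M"
    using ex_extremal_state by blast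
  then interpret extremal_state "bounded_sequences z w" f
      "\<lambda>g. lim (\<lambda>n. g (n, z))" "\<lambda>g. lim (\<lambda>n. g (n, w))" s M .
  define lift :: "'a cdual \<Rightarrow> nat \<times> 'a \<Rightarrow> complex"
    where "lift = (\<lambda>l (n, x). if norm x < 1 then cdual_apply l x else 0)"
  have lift_le: "cmod (lift l \<omega>) \<le> norm l" for l \<omega>
  proof -
    have "cmod (cdual_apply l x) \<le> norm l" if "norm x < 1" for x
      using norm_cdual_apply_le[of l x] that mult_left_le[of "norm x" "norm l"] by simp
    then show ?thesis by (auto simp: lift_def split: prod.splits)
  qed
  have lift_bounded: "bounded_fun (lift l)" for l
    using lift_le by (rule bounded_funI)
  have lift_mem: "lift l \<in> bounded_sequences z w" for l
  proof -
    have "cdual_apply l \<in> holomorphic_maps (ball 0 1) UNIV"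
      by (rule holomorphic_maps_clinear[OF bounded_clinear_cdual_apply])
    then have "(\<lambda>x. lift l (n, x)) \<in> holomorphic_maps (ball 0 1) UNIV" for n
      by (rule holomorphic_maps_cong) (auto simp: lift_def)
    then show ?thesis
      using z w lift_bounded by (simp add: bounded_sequences_def lift_def convergent_const)
  qed
  have lim_lift: "lim (\<lambda>n. lift l (n, z)) = cdual_apply l z" "lim (\<lambda>n. lift l (n, w)) = cdual_apply l w" for l
    using z w by (simp_all add: lift_def)
  have lift_add: "lift (l + m) = (\<lambda>\<omega>. lift l \<omega> + lift m \<omega>)" for l m
    by (auto simp: lift_def plus_cdual.rep_eq)
  have lift_scale: "lift (c *\<^sub>C l) = (\<lambda>\<omega>. c * lift l \<omega>)" for c l
    by (auto simp: lift_def scaleC_cdual.rep_eq)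
  define \<phi> where "\<phi> = (\<lambda>u. Abs_cdual (\<lambda>l. disc u (lift l)))"
  define \<phi>' where "\<phi>' = (\<lambda>u. Abs_cdual (\<lambda>l. disc_deriv u (lift l)))"
  \<comment> \<open>This is the bound of \<open>disc_norm_le\<close> with \<open>C = norm l\<close>
    and \<open>|l z| \<le> norm l * norm z\<close>, divided by \<open>norm l\<close>; it is below 1
    because \<open>norm z < 1\<close>.\<close>
  define b where "b = (\<lambda>u. (1 - (1 - (cmod u)\<^sup>2) / 4) + (1 - (cmod u)\<^sup>2) / 4 * norm z)"
  have disc_le: "cmod (disc u (lift l)) \<le> b u * norm l" if u: "cmod u < 1" for u l
  proof -
    define c where "c = (1 - (cmod u)\<^sup>2) / 4"
    have "c \<ge> 0" using u by (simp add: c_def power_le_one)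
    have "cmod (disc u (lift l)) \<le> (1 - c) * norm l + c * cmod (cdual_apply l z)"
      using disc_norm_le[OF u lift_mem lift_le, of l] unfolding c_def lim_lift .
    also have "\<dots> \<le> (1 - c) * norm l + c * (norm l * norm z)"
      using \<open>c \<ge> 0\<close> by (intro add_left_mono mult_left_mono norm_cdual_apply_le)
    also have "\<dots> = b u * norm l"
      unfolding b_def c_def[symmetric] by (simp add: algebra_simps)
    finally show ?thesis .
  qed
  have \<phi>: "cdual_apply (\<phi> u) l = disc u (lift l)" if u: "cmod u < 1" for u l
    unfolding \<phi>_def
    by (subst Abs_cdual_apply[where C = "b u"])
      (use disc_le[OF u] in \<open>simp_all add: lift_add lift_scale disc_linear u lift_bounded\<close>)
  have \<phi>': "cdual_apply (\<phi>' u) l = disc_deriv u (lift l)" if u: "cmod u < 1" for u l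
    unfolding \<phi>'_def
    by (subst Abs_cdual_apply[where C = "4 / ((1 - s\<^sup>2) * (1 - cmod u)\<^sup>2)"])
      (use disc_deriv_norm_le[OF u lift_le] in
        \<open>simp_all add: lift_add lift_scale disc_linear u lift_bounded mult.commute\<close>)
  have "norm (\<phi> u) < 1" if u: "cmod u < 1" for u
  proof -
    have c: "(1 - (cmod u)\<^sup>2) / 4 > 0" using u by (simp add: power_less_one_iff)
    have "b u \<ge> 0"
      unfolding b_def using c by (intro add_nonneg_nonneg mult_nonneg_nonneg) (auto simp: field_simps)
    then have "norm (\<phi> u) \<le> b u"
      by (rule norm_cdual_le) (use disc_le[OF u] in \<open>simp add: \<phi>[OF u]\<close>)
    also have "(1 - (cmod u)\<^sup>2) / 4 * norm z < (1 - (cmod u)\<^sup>2) / 4 * 1"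
      using c z by (intro mult_strict_left_mono)
    then have "b u < 1" unfolding b_def by simp
    finally show ?thesis .
  qed
  moreover have "\<phi> 0 = bidual_embed z"
    by (rule cdual_eqI) (simp add: \<phi> disc_0[OF lift_mem] cdual_apply_bidual_embed lim_lift)
  moreover have "\<phi> (of_real s) = bidual_embed w"
    by (rule cdual_eqI) (use s in \<open>simp add: \<phi> disc_s[OF lift_mem] cdual_apply_bidual_embed lim_lift\<close>)
  moreover have "norm (\<phi> (u + h) - \<phi> u - h *\<^sub>C \<phi>' u) \<le> 8 / ((1 - s\<^sup>2) * (1 - cmod u) ^ 3) * (cmod h)\<^sup>2"
    if u: "cmod u < 1" and h: "cmod h \<le> (1 - cmod u) / 2" for u h
  proof (rule norm_cdual_le)
    have "s\<^sup>2 < 1" using s by (simp add: power_less_one_iff)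
    then show "0 \<le> 8 / ((1 - s\<^sup>2) * (1 - cmod u) ^ 3) * (cmod h)\<^sup>2"
      using u by simp
    have uh: "cmod (u + h) < 1"
      using norm_triangle_ineq[of u h] h u by (simp add: field_simps)
    show "cmod (cdual_apply (\<phi> (u + h) - \<phi> u - h *\<^sub>C \<phi>' u) l)
        \<le> 8 / ((1 - s\<^sup>2) * (1 - cmod u) ^ 3) * (cmod h)\<^sup>2 * norm l" for l
      using disc_remainder_le[OF u h lift_le, of l]
      by (simp add: minus_cdual.rep_eq scaleC_cdual.rep_eq \<phi> \<phi>' u uh mult_ac)
  qed
  ultimately show ?thesis using s F Fw by (intro that[of s F \<phi> \<phi>'])
qed

section \<open>From the extremal disc to a complex geodesic\<close>

lemma poincare_dist_mono:
  assumes "cmod u < 1" "cmod v < 1"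
    and "cmod ((x - y) / (1 - cnj y * x)) \<le> cmod ((u - v) / (1 - cnj v * u))"
  shows "poincare_dist x y \<le> poincare_dist u v"
proof -
  have "artanh a \<le> artanh b" if "0 \<le> a" "a \<le> b" "b < 1" for a b :: real
  proof -
    have "(1 + a) / (1 - a) \<le> (1 + b) / (1 - b)" using that by (intro frac_le) auto
    then show ?thesis using that by (simp add: artanh_def)
  qed
  with assms show ?thesis
    unfolding poincare_dist_def using moebius_lt_1[OF assms(1,2)] norm_ge_zero by blast
qed

text \<open>Schwarz-Pick for \<open>f \<circ> \<psi>\<close> shows that no \<open>f\<close> exceeds
  the Poincare distance. Conversely \<open>F n \<circ> \<psi>\<close> converges pointwise to the
  identity by \<open>schwarz_almost_extremal\<close>, so the supremum reaches it even if no single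
  function does.\<close>

lemma complex_geodesicI:
  fixes \<psi> :: "complex \<Rightarrow> 'a::complex_normed_vector"
  assumes \<psi>: "\<psi> \<in> holomorphic_maps unit_disc D"
    and F: "\<And>n::nat. F n \<in> holomorphic_maps D unit_disc" "\<And>n. F n (\<psi> 0) = 0"
    and s: "cmod s < 1" "s \<noteq> 0" and Fs: "(\<lambda>n. F n (\<psi> s)) \<longlonglongrightarrow> s"
  shows "complex_geodesic D \<psi>"
  unfolding complex_geodesic_def
proof (intro conjI ballI \<psi>)
  have comp: "(f \<circ> \<psi>) holomorphic_on unit_disc" "(f \<circ> \<psi>) ` unit_disc \<subseteq> unit_disc"
    if "f \<in> holomorphic_maps D unit_disc" for f
    using holomorphic_maps_compose[OF \<psi> that] by (simp_all add: holomorphic_maps_complex_iff)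
  fix u v :: complex assume "u \<in> unit_disc" "v \<in> unit_disc"
  then have u: "cmod u < 1" and v: "cmod v < 1" by auto
  show "ereal (poincare_dist u v) = caratheodory_dist D (\<psi> u) (\<psi> v)"
  proof (rule antisym)
    have lim: "(\<lambda>n. F n (\<psi> x)) \<longlonglongrightarrow> x" if "cmod x < 1" for x
      using schwarz_almost_extremal[of "\<lambda>n. F n \<circ> \<psi>" s x] comp[OF F(1)] F(2) s Fs that by simp
    have v': "cmod ((u - v) / (1 - cnj v * u)) < 1" by (rule moebius_lt_1[OF u v])
    have nz: "1 - cnj v * u \<noteq> 0"
    proof -
      have "cmod (cnj v * u) < 1 * 1"
        unfolding norm_mult complex_mod_cnj using u v by (intro mult_strict_mono') auto
      then show ?thesis by force
    qed
    have "(\<lambda>n. poincare_dist (F n (\<psi> u)) (F n (\<psi> v))) \<longlonglongrightarrow> poincare_dist u v"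
      unfolding poincare_dist_def using v' norm_ge_zero[of "(u - v) / (1 - cnj v * u)"]
      by (intro tendsto_intros lim u v nz) linarith+
    then have "(\<lambda>n. ereal (poincare_dist (F n (\<psi> u)) (F n (\<psi> v)))) \<longlonglongrightarrow> ereal (poincare_dist u v)"
      by simp
    then show "ereal (poincare_dist u v) \<le> caratheodory_dist D (\<psi> u) (\<psi> v)"
      unfolding caratheodory_dist_def
      by (rule LIMSEQ_le_const2) (blast intro: SUP_upper2[OF F(1)])
  next
    have "poincare_dist (f (\<psi> u)) (f (\<psi> v)) \<le> poincare_dist u v"
      if "f \<in> holomorphic_maps D unit_disc" for f
      by (rule poincare_dist_mono[OF u v]) (use schwarz_pick[OF comp[OF that] u v] in simp)
    then show "caratheodory_dist D (\<psi> u) (\<psi> v) \<le> ereal (poincare_dist u v)"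
      unfolding caratheodory_dist_def by (intro SUP_least) simp
  qed
qed

theorem theorem2p5:
  assumes "one_complemented_in_bidual TYPE('a::complex_banach)"
  shows "C_connected (ball (0::'a) 1)"
  unfolding C_connected_def
proof (intro conjI ballI impI)
  show "cdomain (ball (0::'a) 1)"
    by (simp add: cdomain_def convex_connected)
  obtain P :: "'a cdual cdual \<Rightarrow> 'a cdual cdual" where P: "bounded_clinear P" "P \<circ> P = P"
    "range P = range (bidual_embed :: 'a \<Rightarrow> _)" "onorm P = 1"
    using assms by (auto simp: one_complemented_in_bidual_def)
  interpret P: bounded_linear P using P(1) by (simp add: bounded_clinear_def)
  have norm_P: "norm (P x) \<le> norm x" for x
    using onorm[OF P.bounded_linear, of x] P(4) by simp
  have P_embed: "P (bidual_embed x) = bidual_embed x" for x :: 'a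
  proof -
    obtain y where "bidual_embed x = P y" using P(3) by (metis rangeE rangeI)
    then show ?thesis using P(2) by (metis comp_apply)
  qed
  fix z w :: 'a assume "z \<in> ball 0 1" "w \<in> ball 0 1" and zw: "z \<noteq> w"
  then have z: "norm z < 1" and w: "norm w < 1" by auto
  obtain s F and \<phi> \<phi>' :: "complex \<Rightarrow> 'a cdual cdual" where s: "0 < s" "s < 1"
    and F: "\<And>n. F n \<in> holomorphic_maps (ball 0 1) unit_disc" "\<And>n. F n z = 0"
    and Fw: "(\<lambda>n::nat. F n w) \<longlonglongrightarrow> complex_of_real s"
    and \<phi>: "\<phi> 0 = bidual_embed z" "\<phi> (of_real s) = bidual_embed w"
    and \<phi>_less: "\<And>u. cmod u < 1 \<Longrightarrow> norm (\<phi> u) < 1"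
    and \<phi>': "\<And>u h. cmod u < 1 \<Longrightarrow> cmod h \<le> (1 - cmod u) / 2 \<Longrightarrow>
      norm (\<phi> (u + h) - \<phi> u - h *\<^sub>C \<phi>' u) \<le> 8 / ((1 - s\<^sup>2) * (1 - cmod u) ^ 3) * (cmod h)\<^sup>2"
    by (rule ball_extremal_bidual_disc[OF z w zw]) blast
  \<comment> \<open>\<open>P\<close> takes values in the image of the isometric embedding, so
    undoing the embedding gives a linear contraction from the bidual onto X that is the identity on
    X.\<close>
  define R where "R = (\<lambda>x. inv bidual_embed (P x) :: 'a)"
  have R: "bidual_embed (R x) = P x" for x
    unfolding R_def using P(3) by (metis f_inv_into_f rangeI)
  have norm_R: "norm (R x) \<le> norm x" for x
    using norm_P[of x] by (simp add: R[symmetric] norm_bidual_embed)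
  have embed_inj: "x = y" if "bidual_embed x = bidual_embed y" for x y :: 'a
    using that norm_bidual_embed[of "x - y"] by (simp add: bidual_embed_linear)
  have R_diff: "R (x - y) = R x - R y" and R_scale: "R (c *\<^sub>C x) = c *\<^sub>C R x" for x y c
    using P(1) by (auto intro!: embed_inj simp: R bidual_embed_linear P.diff bounded_clinear_def)
  have R_embed: "R (bidual_embed x) = x" for x
    by (rule embed_inj) (simp add: R P_embed)
  define \<psi> where "\<psi> = R \<circ> \<phi>"
  have \<psi>0: "\<psi> 0 = z" and \<psi>s: "\<psi> (of_real s) = w"
    by (simp_all add: \<psi>_def \<phi> R_embed)
  have hol: "\<psi> \<in> holomorphic_maps unit_disc (ball 0 1)"
  proof (rule holomorphic_mapsI)
    fix u :: complex assume "u \<in> unit_disc"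
    then have u: "cmod u < 1" by simp
    show "\<psi> u \<in> ball 0 1"
      using norm_R[of "\<phi> u"] \<phi>_less[OF u] by (simp add: \<psi>_def)
    \<comment> \<open>Being linear and contractive, \<open>R\<close> transports the remainder
      estimate unchanged, with derivative vector \<open>R (\<phi>' u)\<close>.\<close>
    have rem: "norm (\<psi> (u + h) - \<psi> u - h *\<^sub>C R (\<phi>' u)) \<le> 8 / ((1 - s\<^sup>2) * (1 - cmod u) ^ 3) * (cmod h)\<^sup>2"
      if "cmod h \<le> (1 - cmod u) / 2" for h
      using order_trans[OF norm_R \<phi>'[OF u that]] by (simp add: \<psi>_def R_diff R_scale)
    have "(\<psi> has_derivative (\<lambda>h. h *\<^sub>C R (\<phi>' u))) (at u)"
      using u by (intro has_derivative_of_quadratic_remainder[of "(1 - cmod u) / 2", OF _ rem]) auto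
    then show "\<exists>f'. bounded_clinear f' \<and> (\<psi> has_derivative f') (at u)"
      using bounded_clinear_scaleC_left by blast
  qed
  have "complex_geodesic (ball 0 1) \<psi>"
  proof (rule complex_geodesicI[OF hol F(1)])
    show "F n (\<psi> 0) = 0" for n using F(2) \<psi>0 by simp
    show "(\<lambda>n. F n (\<psi> (of_real s))) \<longlonglongrightarrow> complex_of_real s" using Fw \<psi>s by simp
  qed (use s in auto)
  moreover have "\<psi> 0 \<in> \<psi> ` unit_disc" "\<psi> (of_real s) \<in> \<psi> ` unit_disc"
    using s by (intro imageI; simp)+
  ultimately show "\<exists>\<phi>. complex_geodesic (ball 0 1) \<phi> \<and> z \<in> \<phi> ` unit_disc \<and> w \<in> \<phi> ` unit_disc"
    unfolding \<psi>0 \<psi>s by blast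
qed

end
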